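(* Let $0<\alpha<1$, $T>0$, $\Omega=\{(x,t):0<x<1,\ 0<t<T\}$, and let $g:\overline{\Omega}\to\mathbb{R}$ satisfy: $g\in C(\overline{\Omega})$; $g(x,0)=0$ for $0\le x\le 1$; $g(0,t)=g(1,t)$ for $0\le t\le T$; $g_t(x,\cdot)\in L_1[0,T]$ for every $x\in[0,1]$; and $g_x(\cdot,t)\in L_2[0,1]$ for every $t\in[0,T]$. Then the problem $$ {}_{CF}D_{0t}^{\alpha}u(x,t)-u_{xx}(x,t)=g(x,t)\ \text{ in }\Omega,\qquad u(x,0)=0\ (0\le x\le1), $$ $$ u(0,t)=u(1,t)\ (0\le t\le T),\qquad u_x(0,t)=0\ (0<t<T) $$ has a unique regular solution. Writing $p_k=1+(2k\pi)^2(1-\alpha)$, this solution is represented by $$ u(x,t)=(1-\alpha)g_0(t)+\alpha\int_0^t g_0(z)\,dz $$ $$ +\sum_{k=1}^{\infty}\left(\frac{1-\alpha}{p_k}\left[g_{1k}(t)+\frac{4k\pi(1-\alpha)}{p_k}g_{2k}(t)\right]+\frac{\alpha}{p_k^2}\int_0^t e^{-\frac{\alpha(2k\pi)^2(t-z)}{p_k}}\left[g_{1k}(z)+\frac{8k\pi(1-\alpha)}{p_k}g_{2k}(z)+\frac{4k\pi\alpha}{p_k^2}g_{2k}(z)(t-z)\right]dz\right)\cos 2k\pi x $$ $$ +\sum_{k=1}^{\infty}\left(\frac{1-\alpha}{p_k}g_{2k}(t)+\frac{\alpha}{p_k^2}\int_0^t g_{2k}(\xi)\,e^{-\frac{\alpha(2k\pi)^2(t-\xi)}{p_k}}\,d\xi\right)x\sin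 2k\pi x, $$ where $$ g_0(t)=2\int_0^1 g(x,t)(1-x)\,dx,\quad g_{1k}(t)=4\int_0^1 g(x,t)(1-x)\cos 2k\pi x\,dx,\quad g_{2k}(t)=4\int_0^1 g(x,t)\sin 2k\pi x\,dx . $$
   Context: For $0<\alpha<1$ the Caputo-Fabrizio derivative of order $\alpha$ in $t$ is $$ {}_{CF}D_{0t}^{\alpha}u(x,t)=\frac{1}{1-\alpha}\int_0^t u_s(x,s)\,e^{-\frac{\alpha}{1-\alpha}(t-s)}\,ds , $$ and for $u$ merely continuous in $t$ it is understood in the form obtained by integration by parts (which agrees with $\frac{1}{1-\alpha}\int_0^t u_s(x,s)\,e^{-\frac{\alpha}{1-\alpha}(t-s)}\,ds$ when $u(x,\cdot)$ is absolutely continuous): $$ {}_{CF}D_{0t}^{\alpha}u(x,t)=\frac{1}{1-\alpha}\left[u(x,t)-u(x,0)e^{-\frac{\alpha}{1-\alpha}t}\right]-\frac{\alpha}{(1-\alpha)^2}\int_0^t u(x,s)\,e^{-\frac{\alpha}{1-\alpha}(t-s)}\,ds . $$ A regular solution is a function $u\in C(\overline{\Omega})$ such that $u_x$ exists and is continuous on $[0,1]\times(0,T)$ (one-sided derivatives at $x=0,1$), $u_{xx}$ exists and is continuous in $\Omega$, and $u$ satisfies the equation in $\Omega$ and the initial and boundary conditions. *)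

theory Defs
  imports "HOL-Analysis.Analysis"
begin

(* The integrated-by-parts form, which is meaningful for every continuous v; for absolutely
   continuous v it agrees with
   1/(1-\<alpha>) * integral {0..t} (\<lambda>s. v' s * exp (- \<alpha>/(1-\<alpha>) * (t-s))). *)
definition caputo_fabrizio :: "real \<Rightarrow> (real \<Rightarrow> real) \<Rightarrow> real \<Rightarrow> real" where
  "caputo_fabrizio \<alpha> v t =
     1 / (1 - \<alpha>) * (v t - v 0 * exp (- (\<alpha> / (1 - \<alpha>)) * t))
     - \<alpha> / (1 - \<alpha>)^2 * integral {0..t} (\<lambda>s. v s * exp (- (\<alpha> / (1 - \<alpha>)) * (t - s)))"

(* The derivative of f belongs to L_p[a,b], in the usual sense: f is absolutely continuous
   on [a,b], and its almost everywhere derivative h is p-integrable. Absolute continuity is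
   expressed by f being the indefinite integral of h. *)
definition deriv_in_Lp :: "nat \<Rightarrow> real \<Rightarrow> real \<Rightarrow> (real \<Rightarrow> real) \<Rightarrow> bool" where
  "deriv_in_Lp p a b f \<longleftrightarrow>
     (\<exists>h. h \<in> borel_measurable (lebesgue_on {a..b})
        \<and> integrable (lebesgue_on {a..b}) (\<lambda>s. \<bar>h s\<bar> ^ p)
        \<and> (AE s in lebesgue_on {a..b}. (f has_real_derivative h s) (at s))
        \<and> (\<forall>s\<in>{a..b}. f s = f a + integral {a..s} h))"

definition Omega :: "real \<Rightarrow> (real \<times> real) set" where
  "Omega T = {0<..<1} \<times> {0<..<T}"

(* At x = 0 and x = 1 the filter (at x within {0..1}) gives the one-sided derivative u_x. *)
definition regular_solution ::
  "real \<Rightarrow> real \<Rightarrow> (real \<Rightarrow> real \<Rightarrow> real) \<Rightarrow> (real \<Rightarrow> real \<Rightarrow> real) \<Rightarrow> bool" where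
  "regular_solution \<alpha> T g u \<longleftrightarrow>
     continuous_on ({0..1} \<times> {0..T}) (\<lambda>(x,t). u x t) \<and>
     (\<exists>ux uxx.
        (\<forall>x\<in>{0..1}. \<forall>t\<in>{0<..<T}.
           ((\<lambda>y. u y t) has_real_derivative ux x t) (at x within {0..1})) \<and>
        continuous_on ({0..1} \<times> {0<..<T}) (\<lambda>(x,t). ux x t) \<and>
        (\<forall>(x,t)\<in>Omega T. ((\<lambda>y. ux y t) has_real_derivative uxx x t) (at x)) \<and>
        continuous_on (Omega T) (\<lambda>(x,t). uxx x t) \<and>
        (\<forall>(x,t)\<in>Omega T. caputo_fabrizio \<alpha> (u x) t - uxx x t = g x t) \<and>
        (\<forall>t\<in>{0<..<T}. ux 0 t = 0)) \<and>
     (\<forall>x\<in>{0..1}. u x 0 = 0) \<and>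
     (\<forall>t\<in>{0..T}. u 0 t = u 1 t)"

definition g0 :: "(real \<Rightarrow> real \<Rightarrow> real) \<Rightarrow> real \<Rightarrow> real" where
  "g0 g t = 2 * integral {0..1} (\<lambda>x. g x t * (1 - x))"

definition g1 :: "(real \<Rightarrow> real \<Rightarrow> real) \<Rightarrow> nat \<Rightarrow> real \<Rightarrow> real" where
  "g1 g k t = 4 * integral {0..1} (\<lambda>x. g x t * (1 - x) * cos (2 * real k * pi * x))"

definition g2 :: "(real \<Rightarrow> real \<Rightarrow> real) \<Rightarrow> nat \<Rightarrow> real \<Rightarrow> real" where
  "g2 g k t = 4 * integral {0..1} (\<lambda>x. g x t * sin (2 * real k * pi * x))"

definition pk :: "real \<Rightarrow> nat \<Rightarrow> real" where
  "pk \<alpha> k = 1 + (2 * real k * pi)^2 * (1 - \<alpha>)"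

definition u_cos_coeff :: "real \<Rightarrow> (real \<Rightarrow> real \<Rightarrow> real) \<Rightarrow> nat \<Rightarrow> real \<Rightarrow> real" where
  "u_cos_coeff \<alpha> g k t =
     (1 - \<alpha>) / pk \<alpha> k * (g1 g k t + 4 * real k * pi * (1 - \<alpha>) / pk \<alpha> k * g2 g k t)
     + \<alpha> / (pk \<alpha> k)^2 * integral {0..t} (\<lambda>z.
         exp (- (\<alpha> * (2 * real k * pi)^2 * (t - z) / pk \<alpha> k)) *
         (g1 g k z + 8 * real k * pi * (1 - \<alpha>) / pk \<alpha> k * g2 g k z
          + 4 * real k * pi * \<alpha> / (pk \<alpha> k)^2 * g2 g k z * (t - z)))"

definition u_xsin_coeff :: "real \<Rightarrow> (real \<Rightarrow> real \<Rightarrow> real) \<Rightarrow> nat \<Rightarrow> real \<Rightarrow> real" where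
  "u_xsin_coeff \<alpha> g k t =
     (1 - \<alpha>) / pk \<alpha> k * g2 g k t
     + \<alpha> / (pk \<alpha> k)^2 * integral {0..t} (\<lambda>\<xi>.
         g2 g k \<xi> * exp (- (\<alpha> * (2 * real k * pi)^2 * (t - \<xi>) / pk \<alpha> k)))"

end

theory Submission
  imports Defs
begin

text \<open>Uniqueness and the series come from the same computation. Testing the equation against
  \<open>sin (2 k \<pi> x)\<close> and \<open>(1 - x) cos (2 k \<pi> x)\<close>, where the boundary terms cancel, gives a triangular
  system of scalar Caputo-Fabrizio equations for the coefficients of an arbitrary regular solution;
  each of them has an explicit unique solution. Since \<open>u\<^sub>x\<^sub>x\<close> is bounded on \<open>\<Omega>\<close>, the coefficients are
  \<open>O(1/k\<^sup>2)\<close>, so the biorthogonal series converges absolutely, and it converges to the solution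
  because the system is complete.

  For existence, write the equation as \<open>u - (1 - \<alpha>) u\<^sub>x\<^sub>x = (1 - \<alpha>) g + a K u\<close> with \<open>a = \<alpha>/(1 - \<alpha>)\<close> and
  \<open>K\<close> the convolution in \<open>t\<close> with \<open>exp (- a t)\<close>. Inverting the left-hand side explicitly under the boundary
  conditions gives a Volterra equation, a contraction after weighting with \<open>exp (- \<beta> t)\<close> for large \<open>\<beta>\<close>.\<close>

subsection \<open>Scalar Caputo-Fabrizio equations\<close>

text \<open>The spatial problem X'' = - \<lambda> X, X(0) = X(1), X'(0) = 0 is not self-adjoint. For
  \<lambda> = (2 k \<pi>)^2 with k > 0 it has the single eigenfunction cos (2 k \<pi> x), completed
  by the associated function x sin (2 k \<pi> x). The test functions obey the adjoint conditions
  \<phi>(1) = 0, \<phi>'(0) = \<phi>'(1), where sin is the eigenfunction and (1 - x) cos the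
  associated one. So the sine modes decouple and drive the cosine modes at the same decay rate; this
  resonance produces the factor t - z in the series. Nothing is given about u_xx on the boundary of
  \<Omega>. Its bound comes from the equation: u_xx equals the Caputo-Fabrizio derivative minus g,
  which is continuous on the closed rectangle. For the same reason identities obtained for 0 < t < T
  extend to t = 0 and t = T. The Volterra equation does not mention the initial condition; it
  follows at t = 0, where the memory term is empty and g vanishes. The exponential weight makes the
  contraction work for every T at once.\<close>

lemma continuous_on_integral_upper_limit:
  fixes F :: "'a::topological_space \<Rightarrow> real \<Rightarrow> real"
  assumes F: "continuous_on (A \<times> {0..b}) (\<lambda>(x,s). F x s)"
  shows "continuous_on (A \<times> {0..b}) (\<lambda>(x,t). integral {0..t} (F x))"
proof -
  \<comment> \<open>The substitution s = t \<sigma> gives a fixed domain of integration, so the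
    theorem on integrals with a parameter applies. It degenerates at t = 0, where both sides are
    0.\<close>
  have rescale: "integral {0..t} (F x) = t * integral {0..1} (\<lambda>\<sigma>. F x (t * \<sigma>))"
    if "t \<in> {0..b}" for x t
  proof (cases "t = 0")
    case False
    then have "(\<lambda>x. x / t) ` {0..t} = {0..1}"
      using that by (simp add: image_divide_atLeastAtMost)
    then show ?thesis
      using integral_stretch_real[of t 0 t "F x"] False that by simp
  qed simp
  have "continuous_on ((A \<times> {0..b}) \<times> cbox 0 1) ((\<lambda>(x,s). F x s) \<circ> (\<lambda>((x,t),\<sigma>). (x, t * \<sigma>)))"
  proof (rule continuous_on_compose)
    show "continuous_on ((A \<times> {0..b}) \<times> cbox 0 1) (\<lambda>((x,t),\<sigma>::real). (x, t * \<sigma>))"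
      by (auto simp: case_prod_unfold intro!: continuous_intros)
    show "continuous_on ((\<lambda>((x,t),\<sigma>). (x, t * \<sigma>)) ` ((A \<times> {0..b}) \<times> cbox 0 1)) (\<lambda>(x,s). F x s)"
    proof (rule continuous_on_subset[OF F])
      show "(\<lambda>((x,t),\<sigma>). (x, t * \<sigma>)) ` ((A \<times> {0..b}) \<times> cbox 0 1) \<subseteq> A \<times> {0..b}"
        by (auto intro: order_trans[OF mult_right_le_one_le])
    qed
  qed
  then have "continuous_on ((A \<times> {0..b}) \<times> cbox 0 1) (\<lambda>(p,\<sigma>). F (fst p) (snd p * \<sigma>))"
    by (simp add: o_def case_prod_unfold)
  then have "continuous_on (A \<times> {0..b}) (\<lambda>p. integral (cbox 0 1) (\<lambda>\<sigma>. F (fst p) (snd p * \<sigma>)))"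
    by (rule integral_continuous_on_param)
  then have "continuous_on (A \<times> {0..b}) (\<lambda>p. snd p * integral {0..1} (\<lambda>\<sigma>. F (fst p) (snd p * \<sigma>)))"
    by (auto intro!: continuous_intros)
  then show ?thesis
    by (rule continuous_on_eq) (auto simp: rescale)
qed

lemma continuous_on_section:
  assumes "continuous_on (A \<times> B) (\<lambda>(x,t). f x t)"
  shows "x \<in> A \<Longrightarrow> continuous_on B (f x)" and "t \<in> B \<Longrightarrow> continuous_on A (\<lambda>x. f x t)"
  using continuous_on_compose2[OF assms continuous_on_Pair[OF continuous_on_const continuous_on_id], of x]
    continuous_on_compose2[OF assms continuous_on_Pair[OF continuous_on_id continuous_on_const], of t]
  by auto

lemma continuous_on_weighted_integral:
  fixes h :: "real \<Rightarrow> real \<Rightarrow> real" and \<phi> :: "real \<Rightarrow> real"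
  assumes "continuous_on ({0..1} \<times> B) (\<lambda>(x,t). h x t)" and "continuous_on {0..1} \<phi>"
  shows "continuous_on B (\<lambda>t. integral {0..1} (\<lambda>x. h x t * \<phi> x))"
proof -
  have "continuous_on (B \<times> {0..1}) (\<lambda>z. (\<lambda>(x,t). h x t) (snd z, fst z))"
    by (rule continuous_on_compose2[OF assms(1)]) (auto intro!: continuous_intros)
  moreover have "continuous_on (B \<times> {0..1}) (\<lambda>z. \<phi> (snd z))"
    by (rule continuous_on_compose2[OF assms(2)]) (auto intro!: continuous_intros)
  ultimately have "continuous_on (B \<times> cbox 0 1) (\<lambda>(t,x). h x t * \<phi> x)"
    by (auto simp: case_prod_unfold intro!: continuous_intros)
  then show ?thesis
    using integral_continuous_on_param[of B 0 1 "\<lambda>t x. h x t * \<phi> x"] by simp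
qed

text \<open>Serves to carry identities from 0 < t < T, where the differential equation is available,
  to the end points.\<close>

lemma eq_on_Icc_if_eq_on_Ioo:
  fixes f h :: "real \<Rightarrow> real"
  assumes "continuous_on {a..b} f" "continuous_on {a..b} h" "a < b"
    and "\<And>x. x \<in> {a<..<b} \<Longrightarrow> f x = h x" and "x \<in> {a..b}"
  shows "f x = h x"
proof -
  have "closure {a<..<b} = {a..b}"
    using \<open>a < b\<close> by (rule closure_greaterThanLessThan)
  then show ?thesis
    using continuous_constant_on_closure[of "{a<..<b}" "\<lambda>x. f x - h x" 0 x] assms
    by (auto intro!: continuous_intros)
qed

text \<open>Splitting the exponential turns a convolution into an indefinite integral whose
  integrand no longer contains \<open>t\<close>; its derivative and continuity are then
  standard.\<close>

lemma integral_mult_exp_diff: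
  fixes f :: "real \<Rightarrow> real"
  shows "integral S (\<lambda>s. f s * exp (- a * (t - s))) = exp (- a * t) * integral S (\<lambda>s. f s * exp (a * s))"
proof -
  have "(\<lambda>s. f s * exp (- a * (t - s))) = (\<lambda>s. exp (- a * t) * (f s * exp (a * s)))"
    by (auto simp: fun_eq_iff algebra_simps exp_diff exp_minus divide_simps)
  then show ?thesis by simp
qed

text \<open>The solution formula for the scalar equation with derivative of order \<alpha>, damping
  \<open>L\<close> and right-hand side \<open>f\<close>, for a function vanishing at 0. For L = (2 k
  \<pi>)^2 the denominator is \<open>pk \<alpha> k\<close>; for L = 0 the exponential is 1 and the
  memory is a plain integral.\<close>

definition mode_solution :: "real \<Rightarrow> real \<Rightarrow> (real \<Rightarrow> real) \<Rightarrow> real \<Rightarrow> real" where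
  "mode_solution \<alpha> L f t =
     (1 - \<alpha>) / (1 + L * (1 - \<alpha>)) * f t
     + \<alpha> / (1 + L * (1 - \<alpha>))\<^sup>2 *
         integral {0..t} (\<lambda>s. f s * exp (- (\<alpha> * L / (1 + L * (1 - \<alpha>))) * (t - s)))"

text \<open>The memory term \<open>Y\<close> of the Caputo-Fabrizio derivative satisfies a first-order linear
  differential equation, which the integrating factor \<open>exp (\<mu> t)\<close> solves.\<close>

lemma caputo_fabrizio_mode_unique:
  assumes \<alpha>: "0 < \<alpha>" "\<alpha> < 1" and "0 \<le> L"
    and U: "continuous_on {0..T} U" "U 0 = 0" and G: "continuous_on {0..T} G"
    and eq: "\<And>t. t \<in> {0..T} \<Longrightarrow> caputo_fabrizio \<alpha> U t + L * U t = G t"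
    and t: "t \<in> {0..T}"
  shows "U t = mode_solution \<alpha> L G t"
proof -
  define c where "c = 1 - \<alpha>"
  define a where "a = \<alpha> / c"
  define p where "p = 1 + L * c"
  define \<mu> where "\<mu> = \<alpha> * L / p"
  define Y where "Y t = integral {0..t} (\<lambda>s. U s * exp (- a * (t - s)))" for t
  define E where "E t = integral {0..t} (\<lambda>s. U s * exp (a * s))" for t
  have c: "c > 0" and p: "p > 0" and \<alpha>c: "\<alpha> = a * c"
    using \<alpha> \<open>0 \<le> L\<close> by (auto simp: c_def p_def a_def add_pos_nonneg)
  \<comment> \<open>The rate \<open>\<mu>\<close> is \<open>a - a / p\<close>, chosen so that the
    coefficient of \<open>Y\<close> disappears once the integrating factor has been applied.\<close>
  have \<mu>: "\<mu> - a + a / p = 0"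
    using c p unfolding \<mu>_def \<alpha>c by (simp add: field_simps) (simp add: p_def algebra_simps)
  \<comment> \<open>Because \<open>U 0 = 0\<close>, the equation is algebraic in \<open>U\<close> as
    soon as \<open>Y\<close> is known.\<close>
  have U_eq: "U s = (c * G s + a * Y s) / p" if "s \<in> {0..T}" for s
  proof -
    have "1 / c * U s - \<alpha> / c\<^sup>2 * Y s + L * U s = G s"
      using eq[OF that] U(2) by (simp add: caputo_fabrizio_def c_def a_def Y_def)
    then show ?thesis
      using c p by (simp add: \<alpha>c p_def field_simps power2_eq_square)
  qed
  have Y_E: "Y s = exp (- a * s) * E s" for s
    unfolding Y_def E_def by (rule integral_mult_exp_diff)
  have dE: "(E has_real_derivative U s * exp (a * s)) (at s within {0..T})" if "s \<in> {0..T}" for s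
    unfolding E_def using U(1) that by (intro integral_has_real_derivative) (auto intro!: continuous_intros)
  \<comment> \<open>The function differentiated is exp (\<mu> s) Y(s), written through
    \<open>E\<close>, to which the fundamental theorem applies directly.\<close>
  have "((\<lambda>s. exp ((\<mu> - a) * s) * E s) has_real_derivative c / p * (G s * exp (\<mu> * s))) (at s within {0..t})"
    if "s \<in> {0..t}" for s
  proof -
    have s: "s \<in> {0..T}" using that t by auto
    have "((\<lambda>s. exp ((\<mu> - a) * s) * E s) has_real_derivative
        (\<mu> - a) * exp ((\<mu> - a) * s) * E s + exp ((\<mu> - a) * s) * (U s * exp (a * s))) (at s within {0..T})"
      by (auto intro!: derivative_eq_intros dE s)
    also have "(\<mu> - a) * exp ((\<mu> - a) * s) * E s + exp ((\<mu> - a) * s) * (U s * exp (a * s)) =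
        exp (\<mu> * s) * ((\<mu> - a) * Y s + U s)"
      unfolding Y_E by (simp add: algebra_simps exp_diff exp_minus divide_simps)
    also have "(\<mu> - a) * Y s + U s = c / p * G s + (\<mu> - a + a / p) * Y s"
      unfolding U_eq[OF s] by (simp add: algebra_simps add_divide_distrib)
    finally show ?thesis
      unfolding \<mu> using t by (auto simp: mult_ac intro: DERIV_subset)
  qed
  then have "((\<lambda>s. c / p * (G s * exp (\<mu> * s))) has_integral
      exp ((\<mu> - a) * t) * E t - exp ((\<mu> - a) * 0) * E 0) {0..t}"
    using t by (intro fundamental_theorem_of_calculus)
      (auto simp: has_real_derivative_iff_has_vector_derivative)
  then have "exp ((\<mu> - a) * t) * E t = c / p * integral {0..t} (\<lambda>s. G s * exp (\<mu> * s))"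
    by (simp add: E_def has_integral_iff)
  moreover have "Y t = exp (- \<mu> * t) * (exp ((\<mu> - a) * t) * E t)"
    unfolding Y_E by (simp add: algebra_simps flip: exp_add mult.assoc)
  ultimately have "Y t = exp (- \<mu> * t) * (c / p * integral {0..t} (\<lambda>s. G s * exp (\<mu> * s)))"
    by simp
  also have "\<dots> = c / p * integral {0..t} (\<lambda>s. G s * exp (- \<mu> * (t - s)))"
    unfolding integral_mult_exp_diff by simp
  finally have "U t = c / p * G t + a * c / p\<^sup>2 * integral {0..t} (\<lambda>s. G s * exp (- \<mu> * (t - s)))"
    unfolding U_eq[OF t] by (simp add: add_divide_distrib power2_eq_square)
  then show ?thesis
    unfolding mode_solution_def c_def[symmetric] p_def[symmetric] \<mu>_def[symmetric] \<alpha>c[symmetric] .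
qed

text \<open>The kernel exp (- \<mu> t) convolved with itself is t exp (- \<mu> t). Instead of
  exchanging two integrals, the proof integrates the derivative of \<open>H s * (t - s)\<close>,
  which vanishes at both ends.\<close>

lemma integral_iterated_exp:
  fixes f :: "real \<Rightarrow> real"
  assumes f: "continuous_on {0..t} f"
  shows "integral {0..t} (\<lambda>s. integral {0..s} (\<lambda>r. f r * exp (- \<mu> * (s - r))) * exp (- \<mu> * (t - s)))
       = integral {0..t} (\<lambda>s. f s * (t - s) * exp (- \<mu> * (t - s)))"
proof (cases "0 \<le> t")
  case True
  define H where "H s = integral {0..s} (\<lambda>r. f r * exp (\<mu> * r))" for s
  have "((\<lambda>s. H s * (t - s)) has_real_derivative f s * exp (\<mu> * s) * (t - s) - H s) (at s within {0..t})"
    if "s \<in> {0..t}" for s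
  proof -
    have "(H has_real_derivative f s * exp (\<mu> * s)) (at s within {0..t})"
      unfolding H_def using f that by (intro integral_has_real_derivative) (auto intro!: continuous_intros)
    then show ?thesis by (auto intro!: derivative_eq_intros)
  qed
  then have "((\<lambda>s. f s * exp (\<mu> * s) * (t - s) - H s) has_integral H t * (t - t) - H 0 * (t - 0)) {0..t}"
    using True by (intro fundamental_theorem_of_calculus)
      (auto simp: has_real_derivative_iff_has_vector_derivative)
  then have "integral {0..t} (\<lambda>s. f s * exp (\<mu> * s) * (t - s) - H s) = 0"
    by (simp add: H_def has_integral_iff)
  moreover have "continuous_on {0..t} H"
    unfolding H_def using f
    by (intro indefinite_integral_continuous_1 integrable_continuous_interval) (auto intro!: continuous_intros)
  then have "integral {0..t} (\<lambda>s. f s * exp (\<mu> * s) * (t - s) - H s) =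
      integral {0..t} (\<lambda>s. f s * exp (\<mu> * s) * (t - s)) - integral {0..t} H"
    using f by (intro integral_diff integrable_continuous_interval) (auto intro!: continuous_intros)
  ultimately have H: "integral {0..t} H = integral {0..t} (\<lambda>s. f s * (t - s) * exp (\<mu> * s))"
    by (simp add: mult_ac)
  have "integral {0..t} (\<lambda>s. integral {0..s} (\<lambda>r. f r * exp (- \<mu> * (s - r))) * exp (- \<mu> * (t - s)))
      = exp (- \<mu> * t) * integral {0..t} H"
    unfolding integral_mult_exp_diff H_def
    by (simp add: exp_minus field_simps)
  then show ?thesis
    unfolding H integral_mult_exp_diff .
qed simp

lemma continuous_on_mode_integral:
  fixes f :: "real \<Rightarrow> real"
  assumes "continuous_on {0..T} f"
  shows "continuous_on {0..T} (\<lambda>t. integral {0..t} (\<lambda>s. f s * exp (- \<mu> * (t - s))))"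
  unfolding integral_mult_exp_diff using assms
  by (intro continuous_intros indefinite_integral_continuous_1 integrable_continuous_interval)

text \<open>Needed because the closed form of the sine mode is known on the time interval only, not
  as an equation between functions.\<close>

lemma mode_solution_cong:
  assumes "\<And>s. s \<in> {0..t} \<Longrightarrow> f s = h s" "0 \<le> t"
  shows "mode_solution \<alpha> L f t = mode_solution \<alpha> L h t"
proof -
  have "integral {0..t} (\<lambda>s. f s * exp (- (\<alpha> * L / (1 + L * (1 - \<alpha>))) * (t - s))) =
      integral {0..t} (\<lambda>s. h s * exp (- (\<alpha> * L / (1 + L * (1 - \<alpha>))) * (t - s)))"
    by (intro integral_cong) (simp add: assms(1))
  then show ?thesis
    using assms by (simp add: mode_solution_def)
qed

text \<open>This is the shape of a cosine mode driven by a sine mode with the same \<open>L\<close>;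
  there b = 4 k \<pi>. The factor 2 arises because the simple memory integral of \<open>h\<close>
  occurs twice: as the outer instantaneous part of the inner memory, and as the outer memory of the
  inner instantaneous part. Memory of memory gives the term with \<open>t - z\<close>.\<close>

lemma mode_solution_add_mode_solution:
  assumes f: "continuous_on {0..T} f" and h: "continuous_on {0..T} h" and t: "t \<in> {0..T}"
    and p: "p = 1 + L * (1 - \<alpha>)" and \<mu>: "\<mu> = \<alpha> * L / p"
  shows "mode_solution \<alpha> L (\<lambda>s. f s + b * mode_solution \<alpha> L h s) t =
    (1 - \<alpha>) / p * (f t + b * (1 - \<alpha>) / p * h t)
    + \<alpha> / p\<^sup>2 * integral {0..t} (\<lambda>z. exp (- \<mu> * (t - z)) *
         (f z + 2 * b * (1 - \<alpha>) / p * h z + b * \<alpha> / p\<^sup>2 * h z * (t - z)))"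
proof -
  define I where "I f = integral {0..t} (\<lambda>s. f s * exp (- \<mu> * (t - s)))" for f
  define Y where "Y t = integral {0..t} (\<lambda>s. h s * exp (- \<mu> * (t - s)))" for t
  have sub: "{0..t} \<subseteq> {0..T}" using t by auto
  have f': "continuous_on {0..t} f" and h': "continuous_on {0..t} h"
    using f h sub continuous_on_subset by blast+
  have Y': "continuous_on {0..t} Y"
    unfolding Y_def by (rule continuous_on_mode_integral[OF h'])
  have I_add: "I (\<lambda>s. f1 s + f2 s) = I f1 + I f2" if "continuous_on {0..t} f1" "continuous_on {0..t} f2" for f1 f2
  proof -
    have "I (\<lambda>s. f1 s + f2 s) = integral {0..t} (\<lambda>s. f1 s * exp (- \<mu> * (t - s)) + f2 s * exp (- \<mu> * (t - s)))"
      unfolding I_def by (simp add: distrib_right)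
    also have "\<dots> = I f1 + I f2"
      unfolding I_def using that
      by (intro integral_add integrable_continuous_interval continuous_intros)
    finally show ?thesis .
  qed
  have I_mult: "I (\<lambda>s. k * f1 s) = k * I f1" for k f1
    unfolding I_def by (simp add: mult.assoc)
  have IY: "I Y = I (\<lambda>s. h s * (t - s))"
    unfolding I_def Y_def by (rule integral_iterated_exp[OF h'])
  have V: "mode_solution \<alpha> L h s = (1 - \<alpha>) / p * h s + \<alpha> / p\<^sup>2 * Y s" for s
    unfolding mode_solution_def Y_def p[symmetric] \<mu>[symmetric] ..
  have 1: "I (\<lambda>s. f s + b * mode_solution \<alpha> L h s) =
      I f + b * (1 - \<alpha>) / p * I h + b * \<alpha> / p\<^sup>2 * I (\<lambda>s. h s * (t - s))"
  proof -
    have "I (\<lambda>s. f s + b * mode_solution \<alpha> L h s) =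
        I (\<lambda>s. f s + ((b * (1 - \<alpha>) / p) * h s + (b * \<alpha> / p\<^sup>2) * Y s))"
      unfolding V by (simp add: algebra_simps)
    also have "\<dots> = I f + (b * (1 - \<alpha>) / p * I h + b * \<alpha> / p\<^sup>2 * I Y)"
      by (subst I_add, (intro continuous_intros f' h' Y')+)+ (simp only: I_mult)
    finally show ?thesis unfolding IY by simp
  qed
  have 2: "integral {0..t} (\<lambda>z. exp (- \<mu> * (t - z)) *
         (f z + 2 * b * (1 - \<alpha>) / p * h z + b * \<alpha> / p\<^sup>2 * h z * (t - z))) =
      I f + 2 * b * (1 - \<alpha>) / p * I h + b * \<alpha> / p\<^sup>2 * I (\<lambda>s. h s * (t - s))"
  proof -
    have "integral {0..t} (\<lambda>z. exp (- \<mu> * (t - z)) *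
         (f z + 2 * b * (1 - \<alpha>) / p * h z + b * \<alpha> / p\<^sup>2 * h z * (t - z))) =
       I (\<lambda>z. f z + ((2 * b * (1 - \<alpha>) / p) * h z + (b * \<alpha> / p\<^sup>2) * (h z * (t - z))))"
      unfolding I_def by (intro arg_cong2[where f=integral] refl ext) (simp add: algebra_simps)
    also have "\<dots> = I f + (2 * b * (1 - \<alpha>) / p * I h + b * \<alpha> / p\<^sup>2 * I (\<lambda>s. h s * (t - s)))"
      by (subst I_add, (intro continuous_intros f' h')+)+ (simp only: I_mult)
    finally show ?thesis by simp
  qed
  have 3: "mode_solution \<alpha> L (\<lambda>s. f s + b * mode_solution \<alpha> L h s) t =
      (1 - \<alpha>) / p * (f t + b * ((1 - \<alpha>) / p * h t + \<alpha> / p\<^sup>2 * I h)) +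
      \<alpha> / p\<^sup>2 * I (\<lambda>s. f s + b * mode_solution \<alpha> L h s)"
    unfolding V[of t] Y_def I_def[symmetric]
    by (subst mode_solution_def) (simp add: p[symmetric] \<mu>[symmetric] I_def V Y_def)
  show ?thesis
    unfolding 3 1 2 by (simp add: divide_inverse power2_eq_square algebra_simps)
qed

subsection \<open>Completeness of the biorthogonal system\<close>

lemma integral_reflect_unit_interval:
  fixes f :: "real \<Rightarrow> real"
  assumes "continuous_on {0..1} f"
  shows "integral {0..1} (\<lambda>x. f (1 - x)) = integral {0..1} f"
proof -
  have "(\<lambda>x::real. (1 / -1) *\<^sub>R x + -((1 / -1) *\<^sub>R 1)) ` cbox 0 1 = {0..1}"
    by (auto simp: image_iff intro: bexI[where x="1 - _"])
  then have "((\<lambda>x. f (1 - x)) has_integral integral {0..1} f) {0..1}"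
    using has_integral_affinity[of f "integral {0..1} f" 0 1 "-1" 1]
      integrable_integral[OF integrable_continuous_interval[OF assms]]
    by (simp only: interval_cbox) simp
  then show ?thesis by (rule integral_unique)
qed

text \<open>A continuous function symmetric about 1/2 is a continuous function of cos (2 \<pi> x),
  hence a uniform limit of polynomials in cos (2 \<pi> x). Vanishing coefficients make
  \<open>d\<close> orthogonal to all of these, and therefore to itself.\<close>

lemma even_eq_0_if_cos_coeffs_eq_0:
  fixes d :: "real \<Rightarrow> real"
  assumes d: "continuous_on {0..1} d"
    and sym: "\<And>x. x \<in> {0..1} \<Longrightarrow> d (1 - x) = d x"
    and zero: "\<And>k::nat. integral {0..1} (\<lambda>x. d x * cos (2 * real k * pi * x)) = 0"
    and x: "x \<in> {0..1}"
  shows "d x = 0"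
proof -
  \<comment> \<open>The extra factor cos (2 k \<pi> x) strengthens the induction: multiplying by one
    more cos (2 \<pi> x) shifts the frequency to k + 1 and k - 1. For k = 0 the product is already
    the case of frequency 1.\<close>
  have mom: "integral {0..1} (\<lambda>x. d x * cos (2 * pi * x) ^ n * cos (2 * real k * pi * x)) = 0" for n k
  proof (induction n arbitrary: k)
    case 0
    then show ?case using zero by simp
  next
    case (Suc n)
    show ?case
    proof (cases k)
      case 0
      then show ?thesis using Suc[of 1] by (simp add: mult_ac)
    next
      case (Suc j)
      have "cos (2 * pi * x) * cos (2 * real k * pi * x) =
          (cos (2 * real (Suc k) * pi * x) + cos (2 * real j * pi * x)) / 2" for x
        unfolding cos_times_cos by (simp add: Suc algebra_simps flip: cos_minus[of "pi * (x * 2) - _"])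
      then have "(\<lambda>x. d x * cos (2 * pi * x) ^ Suc n * cos (2 * real k * pi * x)) =
          (\<lambda>x. (d x * cos (2 * pi * x) ^ n * cos (2 * real (Suc k) * pi * x)
              + d x * cos (2 * pi * x) ^ n * cos (2 * real j * pi * x)) / 2)"
        by (auto simp: fun_eq_iff distrib_left[symmetric] mult.assoc power_Suc2 simp del: power_Suc)
      then have *: "integral {0..1} (\<lambda>x. d x * cos (2 * pi * x) ^ Suc n * cos (2 * real k * pi * x)) =
          (integral {0..1} (\<lambda>x. d x * cos (2 * pi * x) ^ n * cos (2 * real (Suc k) * pi * x))
          + integral {0..1} (\<lambda>x. d x * cos (2 * pi * x) ^ n * cos (2 * real j * pi * x))) / 2"
        using d by (simp only: integral_divide, subst integral_add)
          (auto intro!: integrable_continuous_interval continuous_intros)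
      show ?thesis unfolding * Suc.IH by simp
    qed
  qed
  have poly: "integral {0..1} (\<lambda>x. d x * q (cos (2 * pi * x))) = 0" if poly_q: "real_polynomial_function q" for q
  proof -
    obtain a n where q: "q = (\<lambda>x. \<Sum>i\<le>n. a i * x ^ i)"
      using poly_q unfolding real_polynomial_function_iff_sum by blast
    have "integral {0..1} (\<lambda>x. d x * q (cos (2 * pi * x))) =
        integral {0..1} (\<lambda>x. \<Sum>i\<le>n. a i * (d x * cos (2 * pi * x) ^ i))"
      by (simp add: q sum_distrib_left mult_ac)
    also have "\<dots> = (\<Sum>i\<le>n. integral {0..1} (\<lambda>x. a i * (d x * cos (2 * pi * x) ^ i)))"
      using d by (intro integral_sum integrable_continuous_interval) (auto intro!: continuous_intros)
    also have "\<dots> = 0"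
      using mom[of _ 0] by simp
    finally show ?thesis .
  qed
  obtain M where M: "\<And>x. x \<in> {0..1} \<Longrightarrow> \<bar>d x\<bar> \<le> M" "M > 0"
    using compact_imp_bounded[OF compact_continuous_image[OF d compact_Icc]]
    unfolding bounded_pos by (metis imageI real_norm_def)
  have "integral {0..1} (\<lambda>x. d x * d x) = 0"
  proof (rule ccontr)
    assume "integral {0..1} (\<lambda>x. d x * d x) \<noteq> 0"
    moreover have "integral {0..1} (\<lambda>x. d x * d x) \<ge> 0"
      by (rule integral_nonneg) (use d in \<open>auto intro!: integrable_continuous_interval continuous_intros\<close>)
    ultimately have pos: "integral {0..1} (\<lambda>x. d x * d x) > 0" by simp
    \<comment> \<open>With this accuracy the error \<open>M * e\<close> is half the integral of
      \<open>d x * d x\<close>, which contradicts its being positive.\<close>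
    define e where "e = integral {0..1} (\<lambda>x. d x * d x) / (2 * M)"
    have "e > 0" using pos M(2) by (simp add: e_def)
    define \<psi> where "\<psi> y = d (arccos y / (2 * pi))" for y
    have "arccos y \<le> 2 * pi" if "y \<in> {-1..1}" for y
      using that by (smt (verit) arccos_ubound atLeastAtMost_iff pi_ge_zero)
    then have "continuous_on {-1..1} \<psi>"
      unfolding \<psi>_def
      by (intro continuous_on_compose2[OF d])
        (auto intro!: continuous_intros simp: arccos_lbound divide_le_eq)
    from Stone_Weierstrass_real_polynomial_function[OF compact_Icc this \<open>e > 0\<close>]
    obtain q where q: "real_polynomial_function q" "\<And>y. y \<in> {-1..1} \<Longrightarrow> \<bar>\<psi> y - q y\<bar> < e"
      by blast
    \<comment> \<open>\<open>arccos\<close> inverts x to cos (2 \<pi> x) only on the left half of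
      the interval; the right half is reached by symmetry.\<close>
    have half: "\<bar>d x - q (cos (2 * pi * x))\<bar> < e" if "0 \<le> x" "x \<le> 1/2" for x
    proof -
      have "arccos (cos (2 * pi * x)) = 2 * pi * x"
        using that by (intro arccos_cos) auto
      then show ?thesis using q(2)[of "cos (2 * pi * x)"] by (simp add: \<psi>_def)
    qed
    have approx: "\<bar>d x - q (cos (2 * pi * x))\<bar> < e" if "x \<in> {0..1}" for x
    proof (cases "x \<le> 1/2")
      case False
      have "cos (2 * pi * (1 - x)) = cos (2 * pi * x)"
        by (simp add: right_diff_distrib cos_diff)
      then show ?thesis using half[of "1 - x"] sym[OF that] that False by simp
    qed (use that half in auto)
    have "continuous_on UNIV q"
      using q(1) by (simp add: continuous_on_polymonial_function real_polynomial_function_eq)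
    then have qc: "continuous_on {0..1} (\<lambda>x. q (cos (2 * pi * x)))"
      by (rule continuous_on_compose2) (auto intro!: continuous_intros)
    have "integral {0..1} (\<lambda>x. d x * d x) =
        integral {0..1} (\<lambda>x. d x * (d x - q (cos (2 * pi * x)))) + integral {0..1} (\<lambda>x. d x * q (cos (2 * pi * x)))"
      using d qc by (subst integral_add[symmetric])
        (auto intro!: integrable_continuous_interval continuous_intros simp: algebra_simps)
    also have "\<dots> = integral {0..1} (\<lambda>x. d x * (d x - q (cos (2 * pi * x))))"
      using poly[OF q(1)] by simp
    also have "\<dots> \<le> integral {0..1} (\<lambda>x::real. M * e)"
    proof (rule integral_le)
      fix x :: real assume x: "x \<in> {0..1}"
      have "d x * (d x - q (cos (2 * pi * x))) \<le> \<bar>d x\<bar> * \<bar>d x - q (cos (2 * pi * x))\<bar>"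
        by (metis abs_ge_self abs_mult)
      also have "\<dots> \<le> M * e"
        using M(1)[OF x] approx[OF x] by (intro mult_mono) auto
      finally show "d x * (d x - q (cos (2 * pi * x))) \<le> M * e" .
    qed (use d qc in \<open>auto intro!: integrable_continuous_interval continuous_intros\<close>)
    also have "\<dots> = integral {0..1} (\<lambda>x. d x * d x) / 2"
      using M(2) by (simp add: e_def)
    finally show False using pos by simp
  qed
  then have "\<forall>x\<in>{0..1}. d x * d x = 0"
    using d by (subst (asm) integral_eq_0_iff) (auto intro!: continuous_intros)
  then show ?thesis using x by simp
qed

text \<open>The product with sin (2 \<pi> x) is even about 1/2, and its cosine coefficients are half
  differences of sine coefficients of \<open>d\<close>. So \<open>d\<close> vanishes except possibly
  at the zeros 0, 1/2, 1 of that sine; there oddness and \<open>d 0 = 0\<close> settle the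
  matter.\<close>

lemma odd_eq_0_if_sin_coeffs_eq_0:
  fixes d :: "real \<Rightarrow> real"
  assumes d: "continuous_on {0..1} d" and "d 0 = 0"
    and odd: "\<And>x. x \<in> {0..1} \<Longrightarrow> d (1 - x) = - d x"
    and zero: "\<And>k::nat. integral {0..1} (\<lambda>x. d x * sin (2 * real k * pi * x)) = 0"
    and x: "x \<in> {0..1}"
  shows "d x = 0"
proof -
  have "d x * sin (2 * pi * x) = 0"
  proof (rule even_eq_0_if_cos_coeffs_eq_0[where d="\<lambda>x. d x * sin (2 * pi * x)", OF _ _ _ x])
    show "continuous_on {0..1} (\<lambda>x. d x * sin (2 * pi * x))"
      by (intro continuous_intros d)
    show "d (1 - x) * sin (2 * pi * (1 - x)) = d x * sin (2 * pi * x)" if "x \<in> {0..1}" for x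
      using odd[OF that] by (simp add: right_diff_distrib sin_diff)
    show "integral {0..1} (\<lambda>x. d x * sin (2 * pi * x) * cos (2 * real k * pi * x)) = 0" for k
    proof (cases k)
      case 0
      then show ?thesis using zero[of 1] by simp
    next
      case (Suc j)
      have "sin (2 * pi * x) * cos (2 * real k * pi * x) =
          (sin (2 * real (Suc k) * pi * x) - sin (2 * real j * pi * x)) / 2" for x
        unfolding sin_times_cos by (simp add: Suc algebra_simps flip: sin_minus[of "pi * (x * 2) - _"])
      then have "(\<lambda>x. d x * sin (2 * pi * x) * cos (2 * real k * pi * x)) =
          (\<lambda>x. (d x * sin (2 * real (Suc k) * pi * x) - d x * sin (2 * real j * pi * x)) / 2)"
        by (auto simp: fun_eq_iff right_diff_distrib[symmetric] mult.assoc)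
      then have *: "integral {0..1} (\<lambda>x. d x * sin (2 * pi * x) * cos (2 * real k * pi * x)) =
          (integral {0..1} (\<lambda>x. d x * sin (2 * real (Suc k) * pi * x))
          - integral {0..1} (\<lambda>x. d x * sin (2 * real j * pi * x))) / 2"
        using d by (simp only: integral_divide, subst integral_diff)
          (auto intro!: integrable_continuous_interval continuous_intros)
      show ?thesis unfolding * zero by simp
    qed
  qed
  moreover have "x = 0 \<or> x = 1/2 \<or> x = 1" if sin0: "sin (2 * pi * x) = 0"
  proof -
    obtain i :: int where "2 * pi * x = of_int i * pi"
      using sin0 unfolding sin_zero_iff_int2 by blast
    then have i: "2 * x = of_int i" by simp
    then have "i = 0 \<or> i = 1 \<or> i = 2" using x by auto
    then show ?thesis using i by auto
  qed
  moreover have "d (1/2) = 0" and "d 1 = 0"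
    using odd[of "1/2"] odd[of 0] \<open>d 0 = 0\<close> by auto
  ultimately show ?thesis
    using \<open>d 0 = 0\<close> by (metis mult_eq_0_iff)
qed

lemma integral_suminf_unit_interval:
  fixes f :: "nat \<Rightarrow> real \<Rightarrow> real"
  assumes f: "\<And>n. continuous_on {0..1} (f n)"
    and M: "\<And>n x. x \<in> {0..1} \<Longrightarrow> \<bar>f n x\<bar> \<le> M n" "summable M"
  shows "continuous_on {0..1} (\<lambda>x. \<Sum>n. f n x)"
    and "(\<lambda>n. integral {0..1} (f n)) sums integral {0..1} (\<lambda>x. \<Sum>n. f n x)"
proof -
  have u: "uniform_limit {0..1} (\<lambda>n x. \<Sum>i<n. f i x) (\<lambda>x. \<Sum>n. f n x) sequentially"
    using M by (intro Weierstrass_m_test) auto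
  show "continuous_on {0..1} (\<lambda>x. \<Sum>n. f n x)"
    by (rule uniform_limit_theorem[OF _ u]) (auto intro!: continuous_intros f always_eventually)
  obtain I J where I: "\<And>n. ((\<lambda>x. \<Sum>i<n. f i x) has_integral I n) {0..1}"
    and J: "((\<lambda>x. \<Sum>n. f n x) has_integral J) {0..1}" and "I \<longlonglongrightarrow> J"
    by (rule uniform_limit_integral[OF u]) (auto intro!: continuous_intros f)
  have "I n = (\<Sum>i<n. integral {0..1} (f i))" for n
    using integral_unique[OF I[of n]] f by (simp add: integral_sum integrable_continuous_interval)
  then have "I = (\<lambda>n. \<Sum>i<n. integral {0..1} (f i))"
    by blast
  with \<open>I \<longlonglongrightarrow> J\<close> J show "(\<lambda>n. integral {0..1} (f n)) sums integral {0..1} (\<lambda>x. \<Sum>n. f n x)"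
    by (auto simp: sums_def integral_unique)
qed

section \<open>Orthogonality relations and the expansion in cos (2 k \<pi> x) and x sin (2 k \<pi>
  x)\<close>

lemma integral_cos_int:
  "integral {0..1} (\<lambda>x. cos (2 * of_int m * pi * x)) = (if m = 0 then 1 else 0)"
proof (cases "m = 0")
  case False
  have "((\<lambda>x. cos (2 * of_int m * pi * x)) has_integral
      sin (2 * of_int m * pi * 1) / (2 * of_int m * pi) - sin (2 * of_int m * pi * 0) / (2 * of_int m * pi)) {0..1}"
    using False by (intro fundamental_theorem_of_calculus)
      (auto intro!: derivative_eq_intros simp flip: has_real_derivative_iff_has_vector_derivative)
  moreover have "sin (2 * of_int m * pi) = 0"
    using sin_int_2pin[of m] by (simp only: mult_ac)
  ultimately show ?thesis using False by (simp add: integral_unique)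
qed simp

lemma integral_cos_cos:
  fixes j k :: nat
  shows "integral {0..1} (\<lambda>x. cos (2 * real (Suc k) * pi * x) * cos (2 * real j * pi * x)) =
    (if j = Suc k then 1/2 else 0)"
proof -
  have "cos (2 * real (Suc k) * pi * x) * cos (2 * real j * pi * x) =
     (cos (2 * of_int (int (Suc k) - int j) * pi * x) + cos (2 * of_int (int (Suc k) + int j) * pi * x)) / 2" for x
    unfolding cos_times_cos by (simp add: algebra_simps)
  then have "integral {0..1} (\<lambda>x. cos (2 * real (Suc k) * pi * x) * cos (2 * real j * pi * x)) =
      (integral {0..1} (\<lambda>x. cos (2 * of_int (int (Suc k) - int j) * pi * x))
      + integral {0..1} (\<lambda>x. cos (2 * of_int (int (Suc k) + int j) * pi * x))) / 2"
    by (simp only: integral_divide, subst integral_add)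
      (intro integrable_continuous_interval continuous_intros refl)+
  then show ?thesis
    unfolding integral_cos_int by auto
qed

lemma integral_sin_sin:
  fixes j k :: nat
  shows "integral {0..1} (\<lambda>x. sin (2 * real (Suc k) * pi * x) * sin (2 * real j * pi * x)) =
    (if j = Suc k then 1/2 else 0)"
proof -
  have "sin (2 * real (Suc k) * pi * x) * sin (2 * real j * pi * x) =
     (cos (2 * of_int (int (Suc k) - int j) * pi * x) - cos (2 * of_int (int (Suc k) + int j) * pi * x)) / 2" for x
    unfolding sin_times_sin by (simp add: algebra_simps)
  then have "integral {0..1} (\<lambda>x. sin (2 * real (Suc k) * pi * x) * sin (2 * real j * pi * x)) =
      (integral {0..1} (\<lambda>x. cos (2 * of_int (int (Suc k) - int j) * pi * x))
      - integral {0..1} (\<lambda>x. cos (2 * of_int (int (Suc k) + int j) * pi * x))) / 2"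
    by (simp only: integral_divide, subst integral_diff)
      (intro integrable_continuous_interval continuous_intros refl)+
  then show ?thesis
    unfolding integral_cos_int by auto
qed

lemma cos_reflect: "cos (2 * real k * pi * (1 - x)) = cos (2 * real k * pi * x)"
  and sin_reflect: "sin (2 * real k * pi * (1 - x)) = - sin (2 * real k * pi * x)"
  by (simp_all only: right_diff_distrib mult_1_right cos_diff sin_diff cos_2npi sin_2npi)

text \<open>Absolute summability makes the series a continuous function that may be integrated term
  by term. What remains after subtracting the mean and the series is even with all cosine
  coefficients zero, so completeness, rather than a pointwise convergence theorem for Fourier
  series, finishes the proof.\<close>

lemma cos_series_even:
  fixes f :: "real \<Rightarrow> real"
  assumes f: "continuous_on {0..1} f"
    and sym: "\<And>x. x \<in> {0..1} \<Longrightarrow> f (1 - x) = f x"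
    and a: "\<And>k. a k = 2 * integral {0..1} (\<lambda>x. f x * cos (2 * real (Suc k) * pi * x))"
    and sm: "summable (\<lambda>k. \<bar>a k\<bar>)"
    and x: "x \<in> {0..1}"
  shows "f x = integral {0..1} f + (\<Sum>k. a k * cos (2 * real (Suc k) * pi * x))"
proof -
  define S where "S x = (\<Sum>k. a k * cos (2 * real (Suc k) * pi * x))" for x
  have S: "continuous_on {0..1} S"
    unfolding S_def using sm
    by (intro integral_suminf_unit_interval(1)[of _ "\<lambda>k. \<bar>a k\<bar>"])
      (auto intro!: continuous_intros simp: abs_mult mult_left_le)
  \<comment> \<open>The coefficient \<open>a k\<close> belongs to frequency \<open>Suc k\<close>,
    hence the index \<open>j - 1\<close>. For \<open>j = 0\<close> truncated subtraction would point
    to \<open>a 0\<close>, so that value is set to 0 separately.\<close>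
  have S_coeff: "integral {0..1} (\<lambda>x. S x * cos (2 * real j * pi * x)) = (if j = 0 then 0 else a (j - 1) / 2)" for j
  proof -
    have "(\<lambda>k. integral {0..1} (\<lambda>x. a k * cos (2 * real (Suc k) * pi * x) * cos (2 * real j * pi * x)))
        sums integral {0..1} (\<lambda>x. \<Sum>k. a k * cos (2 * real (Suc k) * pi * x) * cos (2 * real j * pi * x))"
      using sm by (intro integral_suminf_unit_interval(2)[of _ "\<lambda>k. \<bar>a k\<bar>"])
        (auto intro!: continuous_intros mult_left_le mult_le_one simp: abs_mult mult.assoc)
    moreover have "(\<lambda>k. integral {0..1} (\<lambda>x. a k * cos (2 * real (Suc k) * pi * x) * cos (2 * real j * pi * x)))
        = (\<lambda>k. if k = j - 1 then if j = 0 then 0 else a (j - 1) / 2 else 0)"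
      unfolding mult.assoc[of "a _"] integral_mult_right integral_cos_cos by (auto simp: fun_eq_iff)
    ultimately have *: "integral {0..1} (\<lambda>x. \<Sum>k. a k * cos (2 * real (Suc k) * pi * x) * cos (2 * real j * pi * x)) =
        (if j = 0 then 0 else a (j - 1) / 2)"
      using sums_single[of "j - 1" "\<lambda>_. if j = 0 then 0 else a (j - 1) / 2"] by (simp only: sums_unique2)
    have "(\<Sum>k. a k * cos (2 * real (Suc k) * pi * x) * cos (2 * real j * pi * x)) =
        S x * cos (2 * real j * pi * x)" for x
      unfolding S_def
      by (intro suminf_mult2[symmetric] summable_comparison_test[OF _ sm])
        (auto simp: abs_mult intro!: mult_left_le exI[of _ 0])
    then show ?thesis using * by simp
  qed
  have "f x - integral {0..1} f - S x = 0"
  proof (rule even_eq_0_if_cos_coeffs_eq_0[where d="\<lambda>x. f x - integral {0..1} f - S x", OF _ _ _ x])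
    show "continuous_on {0..1} (\<lambda>x. f x - integral {0..1} f - S x)"
      by (intro continuous_intros f S)
    show "f (1 - x) - integral {0..1} f - S (1 - x) = f x - integral {0..1} f - S x" if "x \<in> {0..1}" for x
      using sym[OF that] by (simp only: S_def cos_reflect)
    show "integral {0..1} (\<lambda>x. (f x - integral {0..1} f - S x) * cos (2 * real k * pi * x)) = 0" for k
    proof -
      have "integral {0..1} (\<lambda>x. (f x - integral {0..1} f - S x) * cos (2 * real k * pi * x)) =
         integral {0..1} (\<lambda>x. f x * cos (2 * real k * pi * x))
         - integral {0..1} (\<lambda>x. integral {0..1} f * cos (2 * real k * pi * x))
         - integral {0..1} (\<lambda>x. S x * cos (2 * real k * pi * x))"
        unfolding left_diff_distrib
        by (subst integral_diff, (intro integrable_continuous_interval continuous_intros f S)+)+ simp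
      also have "\<dots> = 0"
        using integral_cos_int[of "int k"] a[of "k - 1"] by (cases "k = 0") (auto simp: S_coeff S_coeff[of 0, simplified])
      finally show ?thesis .
    qed
  qed
  then show ?thesis by (simp add: S_def)
qed

text \<open>Subtracting the series keeps oddness and the zero at 0, so the completeness result for
  odd functions applies to the remainder.\<close>

lemma sin_series_odd:
  fixes f :: "real \<Rightarrow> real"
  assumes f: "continuous_on {0..1} f" and "f 0 = 0"
    and odd: "\<And>x. x \<in> {0..1} \<Longrightarrow> f (1 - x) = - f x"
    and a: "\<And>k. a k = 2 * integral {0..1} (\<lambda>x. f x * sin (2 * real (Suc k) * pi * x))"
    and sm: "summable (\<lambda>k. \<bar>a k\<bar>)"
    and x: "x \<in> {0..1}"
  shows "f x = (\<Sum>k. a k * sin (2 * real (Suc k) * pi * x))"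
proof -
  define S where "S x = (\<Sum>k. a k * sin (2 * real (Suc k) * pi * x))" for x
  have sum_S: "summable (\<lambda>k. a k * sin (2 * real (Suc k) * pi * x))" for x
    by (rule summable_comparison_test[OF _ sm]) (auto simp: abs_mult intro!: mult_left_le exI[of _ 0])
  have S: "continuous_on {0..1} S"
    unfolding S_def using sm
    by (intro integral_suminf_unit_interval(1)[of _ "\<lambda>k. \<bar>a k\<bar>"])
      (auto intro!: continuous_intros simp: abs_mult mult_left_le)
  have S_coeff: "integral {0..1} (\<lambda>x. S x * sin (2 * real j * pi * x)) = (if j = 0 then 0 else a (j - 1) / 2)" for j
  proof -
    have "(\<lambda>k. integral {0..1} (\<lambda>x. a k * sin (2 * real (Suc k) * pi * x) * sin (2 * real j * pi * x)))
        sums integral {0..1} (\<lambda>x. \<Sum>k. a k * sin (2 * real (Suc k) * pi * x) * sin (2 * real j * pi * x))"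
      using sm by (intro integral_suminf_unit_interval(2)[of _ "\<lambda>k. \<bar>a k\<bar>"])
        (auto intro!: continuous_intros mult_left_le mult_le_one simp: abs_mult mult.assoc)
    moreover have "(\<lambda>k. integral {0..1} (\<lambda>x. a k * sin (2 * real (Suc k) * pi * x) * sin (2 * real j * pi * x)))
        = (\<lambda>k. if k = j - 1 then if j = 0 then 0 else a (j - 1) / 2 else 0)"
      unfolding mult.assoc[of "a _"] integral_mult_right integral_sin_sin by (auto simp: fun_eq_iff)
    ultimately have *: "integral {0..1} (\<lambda>x. \<Sum>k. a k * sin (2 * real (Suc k) * pi * x) * sin (2 * real j * pi * x)) =
        (if j = 0 then 0 else a (j - 1) / 2)"
      using sums_single[of "j - 1" "\<lambda>_. if j = 0 then 0 else a (j - 1) / 2"] by (simp only: sums_unique2)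
    have "(\<Sum>k. a k * sin (2 * real (Suc k) * pi * x) * sin (2 * real j * pi * x)) =
        S x * sin (2 * real j * pi * x)" for x
      unfolding S_def by (intro suminf_mult2[symmetric] sum_S)
    then show ?thesis using * by simp
  qed
  have "f x - S x = 0"
  proof (rule odd_eq_0_if_sin_coeffs_eq_0[where d="\<lambda>x. f x - S x", OF _ _ _ _ x])
    show "continuous_on {0..1} (\<lambda>x. f x - S x)"
      by (intro continuous_intros f S)
    show "f 0 - S 0 = 0" using \<open>f 0 = 0\<close> by (simp add: S_def)
    show "f (1 - x) - S (1 - x) = - (f x - S x)" if "x \<in> {0..1}" for x
      using odd[OF that] suminf_minus[OF sum_S, of x] by (simp add: S_def sin_reflect del: of_nat_Suc)
    show "integral {0..1} (\<lambda>x. (f x - S x) * sin (2 * real k * pi * x)) = 0" for k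
    proof -
      have "integral {0..1} (\<lambda>x. (f x - S x) * sin (2 * real k * pi * x)) =
         integral {0..1} (\<lambda>x. f x * sin (2 * real k * pi * x))
         - integral {0..1} (\<lambda>x. S x * sin (2 * real k * pi * x))"
        unfolding left_diff_distrib
        by (subst integral_diff, (intro integrable_continuous_interval continuous_intros f S)+) simp
      also have "\<dots> = 0"
        using a[of "k - 1"] by (cases "k = 0") (auto simp: S_coeff S_coeff[of 0, simplified])
      finally show ?thesis .
    qed
  qed
  then show ?thesis by (simp add: S_def)
qed

text \<open>With \<open>D x = w x - w (1 - x)\<close> and \<open>E x = (1 - x) w x + x w (1 - x)\<close> one has \<open>w x = E x + x D x\<close>;
  \<open>D\<close> is odd and \<open>E\<close> even about \<open>1/2\<close>, so that they have pure sine and cosine series.\<close>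

lemma biorthogonal_expansion:
  fixes w :: "real \<Rightarrow> real"
  assumes w: "continuous_on {0..1} w" and "w 0 = w 1"
    and A: "\<And>k. A k = 4 * integral {0..1} (\<lambda>x. w x * ((1 - x) * cos (2 * real (Suc k) * pi * x)))"
    and B: "\<And>k. B k = 4 * integral {0..1} (\<lambda>x. w x * sin (2 * real (Suc k) * pi * x))"
    and sm: "summable (\<lambda>k. \<bar>A k\<bar>)" "summable (\<lambda>k. \<bar>B k\<bar>)"
    and x: "x \<in> {0..1}"
  shows "w x = 2 * integral {0..1} (\<lambda>x. w x * (1 - x))
    + (\<Sum>k. A k * cos (2 * real (Suc k) * pi * x))
    + (\<Sum>k. B k * (x * sin (2 * real (Suc k) * pi * x)))"
proof -
  have w': "continuous_on {0..1} (\<lambda>x. w (1 - x))"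
    by (rule continuous_on_compose2[OF w]) (auto intro!: continuous_intros)
  define E where "E x = (1 - x) * w x + x * w (1 - x)" for x
  define D where "D x = w x - w (1 - x)" for x
  \<comment> \<open>The reflection x to 1 - x exchanges the two summands of \<open>E\<close>, which
    therefore contribute equally. The normalisation 4, in place of the usual Fourier factor 2, has
    its origin here.\<close>
  have E: "2 * integral {0..1} (\<lambda>x. w x * ((1 - x) * cos (2 * real k * pi * x)))
      = integral {0..1} (\<lambda>x. E x * cos (2 * real k * pi * x))" for k
  proof -
    have "integral {0..1} (\<lambda>x. E x * cos (2 * real k * pi * x)) =
      integral {0..1} (\<lambda>x. w x * ((1 - x) * cos (2 * real k * pi * x)))
      + integral {0..1} (\<lambda>x. w (1 - x) * ((1 - (1 - x)) * cos (2 * real k * pi * (1 - x))))"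
      unfolding cos_reflect using w w' by (subst integral_add[symmetric])
        (auto intro!: integrable_continuous_interval continuous_intros simp: E_def algebra_simps)
    also have "integral {0..1} (\<lambda>x. w (1 - x) * ((1 - (1 - x)) * cos (2 * real k * pi * (1 - x)))) =
      integral {0..1} (\<lambda>x. w x * ((1 - x) * cos (2 * real k * pi * x)))"
      by (rule integral_reflect_unit_interval) (intro continuous_intros w)
    finally show ?thesis by simp
  qed
  have D: "2 * integral {0..1} (\<lambda>x. w x * sin (2 * real k * pi * x))
      = integral {0..1} (\<lambda>x. D x * sin (2 * real k * pi * x))" for k
  proof -
    have "integral {0..1} (\<lambda>x. D x * sin (2 * real k * pi * x)) =
      integral {0..1} (\<lambda>x. w x * sin (2 * real k * pi * x))
      + integral {0..1} (\<lambda>x. w (1 - x) * sin (2 * real k * pi * (1 - x)))"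
      unfolding sin_reflect using w w' by (subst integral_add[symmetric])
        (auto intro!: integrable_continuous_interval continuous_intros simp: D_def algebra_simps)
    also have "integral {0..1} (\<lambda>x. w (1 - x) * sin (2 * real k * pi * (1 - x))) =
      integral {0..1} (\<lambda>x. w x * sin (2 * real k * pi * x))"
      by (rule integral_reflect_unit_interval) (intro continuous_intros w)
    finally show ?thesis by simp
  qed
  have "E x = integral {0..1} E + (\<Sum>k. A k * cos (2 * real (Suc k) * pi * x))"
  proof (rule cos_series_even[OF _ _ _ sm(1) x])
    show "continuous_on {0..1} E"
      unfolding E_def by (intro continuous_intros w w')
    show "E (1 - x) = E x" for x
      by (simp add: E_def)
    show "A k = 2 * integral {0..1} (\<lambda>x. E x * cos (2 * real (Suc k) * pi * x))" for k
      unfolding A E[symmetric] by simp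
  qed
  moreover have "D x = (\<Sum>k. B k * sin (2 * real (Suc k) * pi * x))"
  proof (rule sin_series_odd[OF _ _ _ _ sm(2) x])
    show "continuous_on {0..1} D"
      unfolding D_def by (intro continuous_intros w w')
    \<comment> \<open>Here the periodicity of \<open>w\<close> enters: a uniformly convergent sine
      series vanishes at 0.\<close>
    show "D 0 = 0" and "D (1 - x) = - D x" for x
      using \<open>w 0 = w 1\<close> by (simp_all add: D_def)
    show "B k = 2 * integral {0..1} (\<lambda>x. D x * sin (2 * real (Suc k) * pi * x))" for k
      unfolding B D[symmetric] by simp
  qed
  moreover have "x * (\<Sum>k. B k * sin (2 * real (Suc k) * pi * x)) =
      (\<Sum>k. B k * (x * sin (2 * real (Suc k) * pi * x)))"
    by (subst suminf_mult[symmetric], rule summable_comparison_test[OF _ sm(2)])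
      (auto simp: abs_mult mult_ac intro!: mult_left_le exI[of _ 0])
  moreover have "w x = E x + x * D x"
    by (simp add: E_def D_def algebra_simps)
  ultimately show ?thesis
    using E[of 0] by (simp add: distrib_left)
qed

subsection \<open>Coefficients of a regular solution\<close>

text \<open>Continuity holds up to t = 0 and t = T. By the equation it yields a continuous extension
  of u_xx to the closed rectangle.\<close>

lemma continuous_on_caputo_fabrizio:
  fixes u :: "real \<Rightarrow> real \<Rightarrow> real"
  assumes u: "continuous_on (A \<times> {0..T}) (\<lambda>(x,t). u x t)" and "0 \<le> T" "\<alpha> \<noteq> 1"
  shows "continuous_on (A \<times> {0..T}) (\<lambda>(x,t). caputo_fabrizio \<alpha> (u x) t)"
proof -
  have u': "continuous_on (A \<times> {0..T}) (\<lambda>z. u (fst z) (snd z))"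
    using u by (simp add: case_prod_unfold)
  have u0: "continuous_on (A \<times> {0..T}) (\<lambda>z. u (fst z) 0)"
    using continuous_on_compose2[OF continuous_on_section(2)[OF u, of 0] continuous_on_fst[OF continuous_on_id], of "A \<times> {0..T}"]
      \<open>0 \<le> T\<close> by auto
  have "continuous_on (A \<times> {0..T}) (\<lambda>(x,t). integral {0..t} (\<lambda>s. u x s * exp (\<alpha> / (1 - \<alpha>) * s)))"
    using u' \<open>\<alpha> \<noteq> 1\<close> by (intro continuous_on_integral_upper_limit)
      (auto simp: case_prod_unfold intro!: continuous_intros)
  then have "continuous_on (A \<times> {0..T}) (\<lambda>z. integral {0..snd z} (\<lambda>s. u (fst z) s * exp (\<alpha> / (1 - \<alpha>) * s)))"
    by (simp add: case_prod_unfold)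
  then show ?thesis
    unfolding caputo_fabrizio_def integral_mult_exp_diff case_prod_unfold
    by (intro continuous_intros u' u0) (use \<open>\<alpha> \<noteq> 1\<close> in auto)
qed

lemma caputo_fabrizio_mult: "caputo_fabrizio \<alpha> (\<lambda>s. c * v s) t = c * caputo_fabrizio \<alpha> v t"
  by (simp add: caputo_fabrizio_def mult.assoc right_diff_distrib)

text \<open>The operator acts in t and the weight in x, so only the memory integral needs an
  exchange of integrations. This reduces the partial differential equation to scalar equations in
  time.\<close>

lemma caputo_fabrizio_weighted_integral:
  fixes u :: "real \<Rightarrow> real \<Rightarrow> real"
  assumes u: "continuous_on ({0..1} \<times> {0..T}) (\<lambda>(x,t). u x t)" and \<phi>: "continuous_on {0..1} \<phi>"
    and t: "t \<in> {0..T}" and \<alpha>: "\<alpha> \<noteq> 1"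
  shows "integral {0..1} (\<lambda>x. caputo_fabrizio \<alpha> (u x) t * \<phi> x) =
    caputo_fabrizio \<alpha> (\<lambda>s. integral {0..1} (\<lambda>x. u x s * \<phi> x)) t"
proof -
  define a where "a = \<alpha> / (1 - \<alpha>)"
  define J where "J x = integral {0..t} (\<lambda>s. u x s * exp (- a * (t - s)))" for x
  have u': "continuous_on ({0..1} \<times> {0..t}) (\<lambda>z. u (fst z) (snd z))"
  proof -
    have "{0..1::real} \<times> {0..t} \<subseteq> {0..1} \<times> {0..T}" using t by auto
    from continuous_on_subset[OF u this] show ?thesis by (simp add: case_prod_unfold)
  qed
  have \<phi>': "continuous_on ({0..1} \<times> {0..t}) (\<lambda>z. \<phi> (fst z))"
    by (rule continuous_on_compose2[OF \<phi>]) (auto intro!: continuous_intros)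
  have J: "continuous_on {0..1} J"
  proof -
    have "continuous_on ({0..1} \<times> cbox 0 t) (\<lambda>(x,s). u x s * exp (- a * (t - s)))"
      using u' by (auto simp: case_prod_unfold intro!: continuous_intros)
    from integral_continuous_on_param[OF this] show ?thesis
      unfolding J_def by simp
  qed
  have ut: "continuous_on {0..1} (\<lambda>x. u x t)" and u0: "continuous_on {0..1} (\<lambda>x. u x 0)"
    using continuous_on_section(2)[OF u] t by auto
  have "continuous_on (cbox (0,0) (1,t)) (\<lambda>(x,s). u x s * exp (- a * (t - s)) * \<phi> x)"
    using u' \<phi>' unfolding cbox_Pair_eq by (auto simp: case_prod_unfold intro!: continuous_intros)
  from integral_swap_continuous[OF this]
  have swap: "integral {0..1} (\<lambda>x. J x * \<phi> x) =
      integral {0..t} (\<lambda>s. integral {0..1} (\<lambda>x. u x s * \<phi> x) * exp (- a * (t - s)))"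
    unfolding J_def by (simp add: mult.assoc mult.left_commute mult.commute flip: integral_mult_left integral_mult_right)
  have "integral {0..1} (\<lambda>x. caputo_fabrizio \<alpha> (u x) t * \<phi> x) =
      integral {0..1} (\<lambda>x. 1 / (1 - \<alpha>) * (u x t * \<phi> x - exp (- a * t) * (u x 0 * \<phi> x))
        - \<alpha> / (1 - \<alpha>)\<^sup>2 * (J x * \<phi> x))"
    by (simp add: caputo_fabrizio_def J_def a_def algebra_simps)
  also have "\<dots> = integral {0..1} (\<lambda>x. 1 / (1 - \<alpha>) * (u x t * \<phi> x - exp (- a * t) * (u x 0 * \<phi> x)))
      - integral {0..1} (\<lambda>x. \<alpha> / (1 - \<alpha>)\<^sup>2 * (J x * \<phi> x))"
    by (intro integral_diff integrable_continuous_interval continuous_on_mult continuous_on_diff continuous_on_const \<phi> J ut u0)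
  also have "integral {0..1} (\<lambda>x. 1 / (1 - \<alpha>) * (u x t * \<phi> x - exp (- a * t) * (u x 0 * \<phi> x))) =
      1 / (1 - \<alpha>) * (integral {0..1} (\<lambda>x. u x t * \<phi> x) - integral {0..1} (\<lambda>x. exp (- a * t) * (u x 0 * \<phi> x)))"
    by (subst integral_mult_right, subst integral_diff)
      (intro integrable_continuous_interval continuous_on_mult continuous_on_const \<phi> u0 ut refl)+
  finally show ?thesis
    unfolding integral_mult_right swap by (simp add: caputo_fabrizio_def a_def)
qed

text \<open>Two integrations by parts at once: u_x \<phi> - u \<phi>' has the derivative u_xx \<phi>
  - u \<phi>''. At the ends, \<open>\<phi> 1 = 0\<close> removes the unknown value u_x(1,t), the
  condition u_x(0,t) = 0 removes the other flux, and \<open>\<phi>' 0 = \<phi>' 1\<close> cancels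
  the remaining terms by periodicity of u.\<close>

lemma regular_solution_weak_form:
  fixes u g :: "real \<Rightarrow> real \<Rightarrow> real"
  assumes u: "regular_solution \<alpha> T g u" and "0 < T" and \<alpha>: "\<alpha> \<noteq> 1"
    and g: "continuous_on ({0..1} \<times> {0..T}) (\<lambda>(x,t). g x t)"
    and \<phi>: "\<And>x. (\<phi> has_real_derivative \<phi>' x) (at x)" "\<And>x. (\<phi>' has_real_derivative \<phi>'' x) (at x)"
    and \<phi>'': "continuous_on {0..1} \<phi>''"
    and bc: "\<phi> 1 = 0" "\<phi>' 0 = \<phi>' 1"
    and t: "t \<in> {0..T}"
  shows "integral {0..1} (\<lambda>x. (caputo_fabrizio \<alpha> (u x) t - g x t) * \<phi> x) = integral {0..1} (\<lambda>x. u x t * \<phi>'' x)"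
proof -
  define q where "q x t = caputo_fabrizio \<alpha> (u x) t - g x t" for x t
  from u obtain ux uxx where
    uc: "continuous_on ({0..1} \<times> {0..T}) (\<lambda>(x,t). u x t)"
    and ux: "\<forall>x\<in>{0..1}. \<forall>t\<in>{0<..<T}. ((\<lambda>y. u y t) has_real_derivative ux x t) (at x within {0..1})"
    and uxc: "continuous_on ({0..1} \<times> {0<..<T}) (\<lambda>(x,t). ux x t)"
    and uxx: "\<forall>(x,t)\<in>Omega T. ((\<lambda>y. ux y t) has_real_derivative uxx x t) (at x)"
    and eq: "\<forall>(x,t)\<in>Omega T. caputo_fabrizio \<alpha> (u x) t - uxx x t = g x t"
    and ux0: "\<forall>t\<in>{0<..<T}. ux 0 t = 0"
    and per: "\<forall>t\<in>{0..T}. u 0 t = u 1 t"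
    unfolding regular_solution_def by blast
  have qc: "continuous_on ({0..1} \<times> {0..T}) (\<lambda>(x,t). q x t)"
    using continuous_on_diff[OF continuous_on_caputo_fabrizio[OF uc _ \<alpha>] g] \<open>0 < T\<close>
    by (simp add: q_def case_prod_unfold)
  have \<phi>c: "continuous_on {0..1} \<phi>" "continuous_on {0..1} \<phi>'"
    using \<phi> by (auto intro!: continuous_at_imp_continuous_on DERIV_isCont)
  have inner: "integral {0..1} (\<lambda>x. q x t * \<phi> x) = integral {0..1} (\<lambda>x. u x t * \<phi>'' x)"
    if t: "t \<in> {0<..<T}" for t
  proof -
    have t': "t \<in> {0..T}" using t by auto
    note uct = continuous_on_section(2)[OF uc t'] and uxct = continuous_on_section(2)[OF uxc t]
      and qct = continuous_on_section(2)[OF qc t']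
    have "((\<lambda>x. q x t * \<phi> x - u x t * \<phi>'' x) has_integral
        (ux 1 t * \<phi> 1 - u 1 t * \<phi>' 1) - (ux 0 t * \<phi> 0 - u 0 t * \<phi>' 0)) {0..1}"
    \<comment> \<open>u_xx is available for 0 < x < 1 only; continuity of u and u_x on the closed
      interval makes up for the end points.\<close>
    proof (rule fundamental_theorem_of_calculus_interior)
      show "continuous_on {0..1} (\<lambda>x. ux x t * \<phi> x - u x t * \<phi>' x)"
        by (intro continuous_intros uct uxct \<phi>c)
      fix x :: real assume x: "x \<in> {0<..<1}"
      then have xt: "(x, t) \<in> Omega T" using t by (simp add: Omega_def)
      have "uxx x t = q x t"
        using bspec[OF eq xt] by (simp add: q_def algebra_simps)
      with bspec[OF uxx xt] have "((\<lambda>y. ux y t) has_real_derivative q x t) (at x)"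
        by simp
      moreover have "((\<lambda>y. u y t) has_real_derivative ux x t) (at x)"
        using bspec[OF bspec[OF ux, of x] t] x at_within_interior[of x "{0..1}"]
        by (auto simp: interior_atLeastAtMost_real)
      ultimately have "((\<lambda>x. ux x t * \<phi> x - u x t * \<phi>' x) has_real_derivative
          q x t * \<phi> x + \<phi>' x * ux x t - (ux x t * \<phi>' x + \<phi>'' x * u x t)) (at x)"
        by (intro DERIV_diff DERIV_mult \<phi>)
      then show "((\<lambda>x. ux x t * \<phi> x - u x t * \<phi>' x) has_vector_derivative q x t * \<phi> x - u x t * \<phi>'' x) (at x)"
        by (simp add: has_real_derivative_iff_has_vector_derivative mult.commute)
    qed simp
    then have "integral {0..1} (\<lambda>x. q x t * \<phi> x - u x t * \<phi>'' x) = 0"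
      using bc ux0 per t t' by (simp add: integral_unique)
    then show ?thesis
      by (subst (asm) integral_diff) (auto intro!: integrable_continuous_interval continuous_intros uct qct \<phi>c \<phi>'')
  qed
  show ?thesis
    unfolding q_def[symmetric]
    by (rule eq_on_Icc_if_eq_on_Ioo[OF _ _ \<open>0 < T\<close> inner t])
      (intro continuous_on_weighted_integral qc uc \<phi>c \<phi>'')+
qed

lemma regular_solution_mode_equation:
  fixes u g :: "real \<Rightarrow> real \<Rightarrow> real"
  assumes u: "regular_solution \<alpha> T g u" and "0 < T" and \<alpha>: "\<alpha> \<noteq> 1"
    and g: "continuous_on ({0..1} \<times> {0..T}) (\<lambda>(x,t). g x t)"
    and \<phi>: "\<And>x. (\<phi> has_real_derivative \<phi>' x) (at x)" "\<And>x. (\<phi>' has_real_derivative \<phi>'' x) (at x)"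
    and \<phi>'': "continuous_on {0..1} \<phi>''"
    and bc: "\<phi> 1 = 0" "\<phi>' 0 = \<phi>' 1"
    and t: "t \<in> {0..T}"
  shows "caputo_fabrizio \<alpha> (\<lambda>s. integral {0..1} (\<lambda>x. u x s * \<phi> x)) t =
    integral {0..1} (\<lambda>x. g x t * \<phi> x) + integral {0..1} (\<lambda>x. u x t * \<phi>'' x)"
proof -
  have uc: "continuous_on ({0..1} \<times> {0..T}) (\<lambda>(x,t). u x t)"
    using u by (simp add: regular_solution_def)
  have \<phi>c: "continuous_on {0..1} \<phi>"
    using \<phi> by (auto intro!: continuous_at_imp_continuous_on DERIV_isCont)
  have "continuous_on {0..1} (\<lambda>x. caputo_fabrizio \<alpha> (u x) t)"
    using continuous_on_section(2)[OF continuous_on_caputo_fabrizio[OF uc _ \<alpha>] t] \<open>0 < T\<close> by simp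
  moreover have "continuous_on {0..1} (\<lambda>x. g x t)"
    by (rule continuous_on_section(2)[OF g t])
  ultimately have "integral {0..1} (\<lambda>x. (caputo_fabrizio \<alpha> (u x) t - g x t) * \<phi> x) =
      integral {0..1} (\<lambda>x. caputo_fabrizio \<alpha> (u x) t * \<phi> x) - integral {0..1} (\<lambda>x. g x t * \<phi> x)"
    unfolding left_diff_distrib
    by (intro integral_diff integrable_continuous_interval continuous_intros \<phi>c)
  then show ?thesis
    using regular_solution_weak_form[OF assms] caputo_fabrizio_weighted_integral[OF uc \<phi>c t \<alpha>] by simp
qed

section \<open>The adjoint modes, their equations in time and their decay\<close>

lemma sin_mode_derivs:
  "((\<lambda>x. sin (l * x)) has_real_derivative l * cos (l * x)) (at x)"
  "((\<lambda>x. l * cos (l * x)) has_real_derivative - (l\<^sup>2) * sin (l * x)) (at x)"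
  by (auto intro!: derivative_eq_intros simp: power2_eq_square)

text \<open>The second derivative is - l^2 times the function plus 2 l sin (l x), so this is an
  associated function of the adjoint problem. The extra term is the coupling: with l = 2 k \<pi> it
  feeds 4 k \<pi> times the sine mode into the cosine mode.\<close>

lemma cos_mode_derivs:
  "((\<lambda>x. (1 - x) * cos (l * x)) has_real_derivative - cos (l * x) - l * (1 - x) * sin (l * x)) (at x)"
  "((\<lambda>x. - cos (l * x) - l * (1 - x) * sin (l * x)) has_real_derivative
      2 * l * sin (l * x) - l\<^sup>2 * ((1 - x) * cos (l * x))) (at x)"
  by (auto intro!: derivative_eq_intros simp: power2_eq_square algebra_simps)

context
  fixes \<alpha> T :: real and g u :: "real \<Rightarrow> real \<Rightarrow> real"
  assumes \<alpha>: "0 < \<alpha>" "\<alpha> < 1" and T: "0 < T"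
    and g: "continuous_on ({0..1} \<times> {0..T}) (\<lambda>(x,t). g x t)"
    and u: "regular_solution \<alpha> T g u"
begin

definition sin_mode :: "nat \<Rightarrow> real \<Rightarrow> real" where
  "sin_mode k t = 4 * integral {0..1} (\<lambda>x. u x t * sin (2 * real k * pi * x))"

definition cos_mode :: "nat \<Rightarrow> real \<Rightarrow> real" where
  "cos_mode k t = 4 * integral {0..1} (\<lambda>x. u x t * ((1 - x) * cos (2 * real k * pi * x)))"

lemma \<alpha>': "\<alpha> \<noteq> 1"
  using \<alpha> by simp

lemma u_continuous: "continuous_on ({0..1} \<times> {0..T}) (\<lambda>(x,t). u x t)"
  and u_initial: "x \<in> {0..1} \<Longrightarrow> u x 0 = 0"
  and u_periodic: "t \<in> {0..T} \<Longrightarrow> u 0 t = u 1 t"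
  using u by (auto simp: regular_solution_def)

lemma u_weighted_initial: "integral {0..1} (\<lambda>x. u x 0 * \<phi> x) = 0"
proof -
  have "integral {0..1} (\<lambda>x. u x 0 * \<phi> x) = integral {0..1} (\<lambda>x::real. 0::real)"
    by (intro integral_cong) (simp add: u_initial)
  then show ?thesis by simp
qed

lemma continuous_on_modes:
  "continuous_on {0..T} (sin_mode k)" "continuous_on {0..T} (cos_mode k)"
  unfolding sin_mode_def cos_mode_def
  by (intro continuous_intros continuous_on_weighted_integral u_continuous)+

lemma continuous_on_data_modes:
  "continuous_on {0..T} (g0 g)" "continuous_on {0..T} (g1 g k)" "continuous_on {0..T} (g2 g k)"
  unfolding g0_def g1_def g2_def mult.assoc
  by (intro continuous_intros continuous_on_weighted_integral g)+

lemma bc_sin: "sin (2 * real k * pi) = 0" and bc_cos: "cos (2 * real k * pi) = 1"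
  using sin_int_2pin[of "int k"] cos_int_2pin[of "int k"] by (simp_all add: mult_ac)

lemma integral_cos_mode_deriv2:
  assumes "t \<in> {0..T}"
  shows "integral {0..1} (\<lambda>x. u x t * (2 * l * sin (l * x) - l\<^sup>2 * ((1 - x) * cos (l * x)))) =
    2 * l * integral {0..1} (\<lambda>x. u x t * sin (l * x))
    - l\<^sup>2 * integral {0..1} (\<lambda>x. u x t * ((1 - x) * cos (l * x)))"
proof -
  have "integral {0..1} (\<lambda>x. u x t * (2 * l * sin (l * x) - l\<^sup>2 * ((1 - x) * cos (l * x)))) =
    integral {0..1} (\<lambda>x. 2 * l * (u x t * sin (l * x)) - l\<^sup>2 * (u x t * ((1 - x) * cos (l * x))))"
    by (simp add: algebra_simps)
  also have "\<dots> = integral {0..1} (\<lambda>x. 2 * l * (u x t * sin (l * x)))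
      - integral {0..1} (\<lambda>x. l\<^sup>2 * (u x t * ((1 - x) * cos (l * x))))"
    using continuous_on_section(2)[OF u_continuous assms]
    by (intro integral_diff integrable_continuous_interval continuous_intros)
  finally show ?thesis by simp
qed

lemma sin_mode_equation:
  assumes t: "t \<in> {0..T}"
  shows "caputo_fabrizio \<alpha> (sin_mode k) t + (2 * real k * pi)\<^sup>2 * sin_mode k t = g2 g k t"
proof -
  have "caputo_fabrizio \<alpha> (\<lambda>s. integral {0..1} (\<lambda>x. u x s * sin (2 * real k * pi * x))) t =
      integral {0..1} (\<lambda>x. g x t * sin (2 * real k * pi * x))
      + integral {0..1} (\<lambda>x. u x t * (- ((2 * real k * pi)\<^sup>2) * sin (2 * real k * pi * x)))"
    by (rule regular_solution_mode_equation[OF u T \<alpha>' g sin_mode_derivs _ _ _ t])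
      (auto intro!: continuous_intros simp: bc_sin bc_cos)
  also have "\<dots> = integral {0..1} (\<lambda>x. g x t * sin (2 * real k * pi * x))
      - (2 * real k * pi)\<^sup>2 * integral {0..1} (\<lambda>x. u x t * sin (2 * real k * pi * x))"
    by (simp add: mult.left_commute[of "u _ t"])
  finally show ?thesis
    unfolding sin_mode_def caputo_fabrizio_mult g2_def by (simp add: algebra_simps)
qed

lemma cos_mode_equation:
  assumes t: "t \<in> {0..T}"
  shows "caputo_fabrizio \<alpha> (cos_mode k) t + (2 * real k * pi)\<^sup>2 * cos_mode k t =
    g1 g k t + 4 * real k * pi * sin_mode k t"
proof -
  have "caputo_fabrizio \<alpha> (\<lambda>s. integral {0..1} (\<lambda>x. u x s * ((1 - x) * cos (2 * real k * pi * x)))) t =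
      integral {0..1} (\<lambda>x. g x t * ((1 - x) * cos (2 * real k * pi * x)))
      + integral {0..1} (\<lambda>x. u x t * (2 * (2 * real k * pi) * sin (2 * real k * pi * x)
          - (2 * real k * pi)\<^sup>2 * ((1 - x) * cos (2 * real k * pi * x))))"
    by (rule regular_solution_mode_equation[OF u T \<alpha>' g cos_mode_derivs _ _ _ t])
      (auto intro!: continuous_intros simp: bc_sin bc_cos)
  then show ?thesis
    unfolding integral_cos_mode_deriv2[OF t] sin_mode_def cos_mode_def caputo_fabrizio_mult g1_def
    by (simp add: algebra_simps)
qed

lemma sin_mode_eq:
  assumes t: "t \<in> {0..T}"
  shows "sin_mode k t = mode_solution \<alpha> ((2 * real k * pi)\<^sup>2) (g2 g k) t"
  by (rule caputo_fabrizio_mode_unique[OF \<alpha> _ continuous_on_modes(1) _ continuous_on_data_modes(3) sin_mode_equation t])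
    (auto simp: sin_mode_def u_weighted_initial)

lemma cos_mode_eq:
  assumes t: "t \<in> {0..T}"
  shows "cos_mode k t =
    mode_solution \<alpha> ((2 * real k * pi)\<^sup>2) (\<lambda>s. g1 g k s + 4 * real k * pi * sin_mode k s) t"
  by (rule caputo_fabrizio_mode_unique[OF \<alpha> _ continuous_on_modes(2) _ _ cos_mode_equation t])
    (auto simp: cos_mode_def u_weighted_initial intro!: continuous_intros continuous_on_modes continuous_on_data_modes)

lemma sin_mode_eq_u_xsin_coeff:
  assumes t: "t \<in> {0..T}"
  shows "sin_mode k t = u_xsin_coeff \<alpha> g k t"
  unfolding sin_mode_eq[OF t] mode_solution_def u_xsin_coeff_def pk_def by simp

lemma cos_mode_eq_u_cos_coeff:
  assumes t: "t \<in> {0..T}"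
  shows "cos_mode k t = u_cos_coeff \<alpha> g k t"
proof -
  have "cos_mode k t = mode_solution \<alpha> ((2 * real k * pi)\<^sup>2)
      (\<lambda>s. g1 g k s + 4 * real k * pi * mode_solution \<alpha> ((2 * real k * pi)\<^sup>2) (g2 g k) s) t"
    unfolding cos_mode_eq[OF t] using t by (intro mode_solution_cong) (auto simp: sin_mode_eq)
  also have "\<dots> = u_cos_coeff \<alpha> g k t"
    by (subst mode_solution_add_mode_solution[OF continuous_on_data_modes(2,3) t refl refl])
      (simp add: u_cos_coeff_def pk_def mult_ac)
  finally show ?thesis .
qed

text \<open>This is the cosine equation for k = 0, where both the damping and the coupling vanish;
  the normalisation is 2 instead of 4.\<close>

lemma mean_eq:
  assumes t: "t \<in> {0..T}"
  shows "2 * integral {0..1} (\<lambda>x. u x t * (1 - x)) = (1 - \<alpha>) * g0 g t + \<alpha> * integral {0..t} (g0 g)"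
proof -
  have eq: "caputo_fabrizio \<alpha> (\<lambda>s. 2 * integral {0..1} (\<lambda>x. u x s * (1 - x))) s
      + 0 * (2 * integral {0..1} (\<lambda>x. u x s * (1 - x))) = g0 g s" if s: "s \<in> {0..T}" for s
  proof -
    have "cos_mode 0 = (\<lambda>s. 4 * integral {0..1} (\<lambda>x. u x s * (1 - x)))"
      by (simp add: cos_mode_def fun_eq_iff)
    then show ?thesis
      using cos_mode_equation[OF s, of 0] by (simp add: caputo_fabrizio_mult g0_def g1_def)
  qed
  have "2 * integral {0..1} (\<lambda>x. u x t * (1 - x)) = mode_solution \<alpha> 0 (g0 g) t"
    by (rule caputo_fabrizio_mode_unique[OF \<alpha> _ _ _ continuous_on_data_modes(1) eq t])
      (auto simp: u_weighted_initial intro!: continuous_intros continuous_on_weighted_integral u_continuous)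
  then show ?thesis
    by (simp add: mode_solution_def)
qed

text \<open>The weak form moves both x-derivatives to the weight, so l^2 times a mode is controlled
  by an integral of u_xx against a function bounded by 1. The bound \<open>N\<close> depends neither
  on k nor on t.\<close>

lemma mode_bounds:
  obtains M where "\<And>k t. t \<in> {0..T} \<Longrightarrow> \<bar>sin_mode (Suc k) t\<bar> \<le> M * inverse (real (Suc k) ^ 2)"
    and "\<And>k t. t \<in> {0..T} \<Longrightarrow> \<bar>cos_mode (Suc k) t\<bar> \<le> M * inverse (real (Suc k) ^ 2)"
proof -
  define q where "q x t = caputo_fabrizio \<alpha> (u x) t - g x t" for x t
  have qc: "continuous_on ({0..1} \<times> {0..T}) (\<lambda>(x,t). q x t)"
    using continuous_on_diff[OF continuous_on_caputo_fabrizio[OF u_continuous _ \<alpha>'] g] T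
    by (simp add: q_def case_prod_unfold)
  obtain N where N: "N > 0" "\<forall>y\<in>(\<lambda>(x,t). q x t) ` ({0..1} \<times> {0..T}). norm y \<le> N"
    using compact_imp_bounded[OF compact_continuous_image[OF qc]] unfolding bounded_pos
    by (auto intro: compact_Times)
  have bound: "\<bar>integral {0..1} (\<lambda>x. u x t * \<phi>'' x)\<bar> \<le> N"
    if \<phi>: "\<And>x. (\<phi> has_real_derivative \<phi>' x) (at x)" "\<And>x. (\<phi>' has_real_derivative \<phi>'' x) (at x)"
      "continuous_on {0..1} \<phi>''" "\<phi> 1 = 0" "\<phi>' 0 = \<phi>' 1" and \<phi>_le: "\<And>x. x \<in> {0..1} \<Longrightarrow> \<bar>\<phi> x\<bar> \<le> 1"
      and t: "t \<in> {0..T}" for \<phi> \<phi>' \<phi>'' t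
  proof -
    have \<phi>c: "continuous_on {0..1} \<phi>"
      using \<phi>(1) by (auto intro!: continuous_at_imp_continuous_on DERIV_isCont)
    have "norm (integral {0..1} (\<lambda>x. q x t * \<phi> x)) \<le> N * (1 - 0)"
    proof (rule integral_bound)
      show "continuous_on {0..1} (\<lambda>x. q x t * \<phi> x)"
        by (intro continuous_intros \<phi>c continuous_on_section(2)[OF qc t])
      show "norm (q x t * \<phi> x) \<le> N" if x: "x \<in> {0..1}" for x
      proof -
        have "\<bar>q x t\<bar> \<le> N" using N(2) x t by force
        then show ?thesis
          using mult_mono[of "\<bar>q x t\<bar>" N "\<bar>\<phi> x\<bar>" 1] \<phi>_le[OF x] N(1) by (simp add: abs_mult)
      qed
    qed simp
    then show ?thesis
      using regular_solution_weak_form[OF u T \<alpha>' g \<phi> t] by (simp add: q_def)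
  qed
  define l where "l k = 2 * real (Suc k) * pi" for k
  have l: "l k \<ge> real (Suc k)" "l k \<ge> 1" for k
  proof -
    have "real (Suc k) * 1 \<le> real (Suc k) * (2 * pi)"
      using pi_gt3 by (intro mult_left_mono) auto
    then show "l k \<ge> real (Suc k)"
      by (simp add: l_def mult_ac del: of_nat_Suc)
    then show "l k \<ge> 1" by simp
  qed
  have sin_le: "(l k)\<^sup>2 * \<bar>sin_mode (Suc k) t\<bar> \<le> 4 * N" if t: "t \<in> {0..T}" for k t
  proof -
    have "\<bar>integral {0..1} (\<lambda>x. u x t * (- ((l k)\<^sup>2) * sin (l k * x)))\<bar> \<le> N"
      by (rule bound[OF sin_mode_derivs _ _ _ _ t])
        (use bc_sin[of "Suc k"] bc_cos[of "Suc k"] in \<open>auto intro!: continuous_intros simp: l_def\<close>)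
    moreover have "integral {0..1} (\<lambda>x. u x t * (- ((l k)\<^sup>2) * sin (l k * x))) = - ((l k)\<^sup>2 * sin_mode (Suc k) t / 4)"
      unfolding sin_mode_def l_def[symmetric] by (simp add: mult.left_commute[of "u _ t"])
    ultimately show ?thesis
      by (simp add: abs_mult)
  qed
  \<comment> \<open>The constant is 12 = 4 + 2 * 4: a contribution 4 N from the weak form, and the
    coupling term, which is at most twice the sine bound because l \<le> l^2.\<close>
  have cos_le: "(l k)\<^sup>2 * \<bar>cos_mode (Suc k) t\<bar> \<le> 12 * N" if t: "t \<in> {0..T}" for k t
  proof -
    have "\<bar>integral {0..1} (\<lambda>x. u x t * (2 * l k * sin (l k * x) - (l k)\<^sup>2 * ((1 - x) * cos (l k * x))))\<bar> \<le> N"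
      by (rule bound[OF cos_mode_derivs _ _ _ _ t])
        (use bc_sin[of "Suc k"] bc_cos[of "Suc k"] in \<open>auto intro!: continuous_intros mult_le_one simp: l_def abs_mult\<close>)
    then have "\<bar>2 * l k * sin_mode (Suc k) t - (l k)\<^sup>2 * cos_mode (Suc k) t\<bar> \<le> 4 * N"
      unfolding integral_cos_mode_deriv2[OF t] sin_mode_def cos_mode_def l_def[symmetric] by linarith
    then have "(l k)\<^sup>2 * \<bar>cos_mode (Suc k) t\<bar> \<le> 4 * N + 2 * l k * \<bar>sin_mode (Suc k) t\<bar>"
      using l(2)[of k] abs_mult[of "2 * l k" "sin_mode (Suc k) t"] abs_mult[of "(l k)\<^sup>2" "cos_mode (Suc k) t"] by simp
    moreover have "l k * \<bar>sin_mode (Suc k) t\<bar> \<le> (l k)\<^sup>2 * \<bar>sin_mode (Suc k) t\<bar>"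
      using l(2)[of k] by (intro mult_right_mono self_le_power) auto
    ultimately show ?thesis using sin_le[OF t, of k] by linarith
  qed
  have le: "\<bar>c\<bar> \<le> 12 * N * inverse (real (Suc k) ^ 2)" if "(l k)\<^sup>2 * \<bar>c\<bar> \<le> 12 * N" for c k
  proof -
    have "real (Suc k) ^ 2 * \<bar>c\<bar> \<le> (l k)\<^sup>2 * \<bar>c\<bar>"
      using l(1)[of k] by (intro mult_right_mono power_mono) auto
    with that have "real (Suc k) ^ 2 * \<bar>c\<bar> \<le> 12 * N" by linarith
    then show ?thesis
      by (simp add: divide_inverse[symmetric] pos_le_divide_eq mult.commute del: of_nat_Suc)
  qed
  show thesis
  proof (rule that[of "12 * N"])
    show "\<bar>sin_mode (Suc k) t\<bar> \<le> 12 * N * inverse (real (Suc k) ^ 2)" if "t \<in> {0..T}" for k t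
      using sin_le[OF that, of k] N(1) by (intro le) linarith
    show "\<bar>cos_mode (Suc k) t\<bar> \<le> 12 * N * inverse (real (Suc k) ^ 2)" if "t \<in> {0..T}" for k t
      by (intro le cos_le that)
  qed
qed

lemma summable_modes:
  assumes t: "t \<in> {0..T}"
  shows "summable (\<lambda>k. \<bar>cos_mode (Suc k) t\<bar>)" "summable (\<lambda>k. \<bar>sin_mode (Suc k) t\<bar>)"
proof -
  obtain M where M: "\<And>k t. t \<in> {0..T} \<Longrightarrow> \<bar>sin_mode (Suc k) t\<bar> \<le> M * inverse (real (Suc k) ^ 2)"
    "\<And>k t. t \<in> {0..T} \<Longrightarrow> \<bar>cos_mode (Suc k) t\<bar> \<le> M * inverse (real (Suc k) ^ 2)"
    by (rule mode_bounds) blast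
  have sm: "summable (\<lambda>k. M * inverse (real (Suc k) ^ 2))"
    by (intro summable_mult, subst summable_Suc_iff) (simp add: inverse_power_summable)
  show "summable (\<lambda>k. \<bar>cos_mode (Suc k) t\<bar>)" "summable (\<lambda>k. \<bar>sin_mode (Suc k) t\<bar>)"
    using M[OF t] by (simp_all only: summable_comparison_test'[OF sm, of 0] real_norm_def abs_abs)
qed

lemma regular_solution_representation:
  assumes x: "x \<in> {0..1}" and t: "t \<in> {0..T}"
  shows "summable (\<lambda>k. u_cos_coeff \<alpha> g (Suc k) t * cos (2 * real (Suc k) * pi * x))"
    and "summable (\<lambda>k. u_xsin_coeff \<alpha> g (Suc k) t * (x * sin (2 * real (Suc k) * pi * x)))"
    and "u x t = (1 - \<alpha>) * g0 g t + \<alpha> * integral {0..t} (g0 g)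
           + (\<Sum>k. u_cos_coeff \<alpha> g (Suc k) t * cos (2 * real (Suc k) * pi * x))
           + (\<Sum>k. u_xsin_coeff \<alpha> g (Suc k) t * (x * sin (2 * real (Suc k) * pi * x)))"
proof -
  note sm = summable_modes[OF t, unfolded cos_mode_eq_u_cos_coeff[OF t] sin_mode_eq_u_xsin_coeff[OF t]]
  show "summable (\<lambda>k. u_cos_coeff \<alpha> g (Suc k) t * cos (2 * real (Suc k) * pi * x))"
    by (rule summable_comparison_test'[OF sm(1), of 0]) (simp add: abs_mult mult_left_le)
  have "\<bar>x * sin (2 * real (Suc k) * pi * x)\<bar> \<le> 1" for k
    using x by (simp add: abs_mult mult_le_one)
  then show "summable (\<lambda>k. u_xsin_coeff \<alpha> g (Suc k) t * (x * sin (2 * real (Suc k) * pi * x)))"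
    by (intro summable_comparison_test'[OF sm(2), of 0]) (simp only: real_norm_def abs_mult[of "u_xsin_coeff _ _ _ _"] mult_left_le abs_ge_zero)
  show "u x t = (1 - \<alpha>) * g0 g t + \<alpha> * integral {0..t} (g0 g)
           + (\<Sum>k. u_cos_coeff \<alpha> g (Suc k) t * cos (2 * real (Suc k) * pi * x))
           + (\<Sum>k. u_xsin_coeff \<alpha> g (Suc k) t * (x * sin (2 * real (Suc k) * pi * x)))"
    unfolding mean_eq[OF t, symmetric]
    by (rule biorthogonal_expansion[OF continuous_on_section(2)[OF u_continuous t] u_periodic[OF t] _ _ sm x])
      (simp_all only: cos_mode_def sin_mode_def flip: cos_mode_eq_u_cos_coeff[OF t] sin_mode_eq_u_xsin_coeff[OF t])
qed

end

subsection \<open>Existence\<close>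

text \<open>Banach's theorem is applied in the complete space of bounded continuous functions on the
  whole space. A function on the box enters it by composition with \<open>clamp\<close>, which
  retracts the space onto the box and does not increase suprema.\<close>

lemma contraction_fixed_point_cbox:
  fixes \<Phi> :: "('a::euclidean_space \<Rightarrow> real) \<Rightarrow> 'a \<Rightarrow> real"
  assumes ne: "cbox a b \<noteq> {}" and q: "0 \<le> q" "q < 1"
    and cont: "\<And>u. continuous_on (cbox a b) u \<Longrightarrow> continuous_on (cbox a b) (\<Phi> u)"
    and contr: "\<And>u v M z. \<lbrakk>continuous_on (cbox a b) u; continuous_on (cbox a b) v;
        \<And>z. z \<in> cbox a b \<Longrightarrow> \<bar>u z - v z\<bar> \<le> M; z \<in> cbox a b\<rbrakk> \<Longrightarrow> \<bar>\<Phi> u z - \<Phi> v z\<bar> \<le> q * M"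
  obtains u where "continuous_on (cbox a b) u" "\<And>z. z \<in> cbox a b \<Longrightarrow> \<Phi> u z = u z"
proof -
  have "\<exists>h :: 'a \<Rightarrow>\<^sub>C real. \<forall>z. h z = \<Phi> (apply_bcontfun f) (clamp a b z)" for f :: "'a \<Rightarrow>\<^sub>C real"
    by (rule continuous_on_cbox_bcontfunE[OF cont[of "apply_bcontfun f"]]) auto
  then obtain \<Psi> :: "('a \<Rightarrow>\<^sub>C real) \<Rightarrow> 'a \<Rightarrow>\<^sub>C real"
    where \<Psi>: "\<And>f z. \<Psi> f z = \<Phi> (apply_bcontfun f) (clamp a b z)"
    by metis
  have clamp: "clamp a b z \<in> cbox a b" for z
    using ne by (intro clamp_in_interval) (simp add: box_ne_empty)
  have "dist (\<Psi> f) (\<Psi> h) \<le> q * dist f h" for f h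
  proof (rule dist_bound)
    fix z
    show "dist (\<Psi> f z) (\<Psi> h z) \<le> q * dist f h"
      using contr[of "apply_bcontfun f" "apply_bcontfun h" "dist f h" "clamp a b z"] dist_bounded[of f _ h] clamp
      by (simp add: \<Psi> dist_real_def)
  qed
  then obtain f where f: "\<Psi> f = f"
    using banach_fix_type[OF q, of \<Psi>] by blast
  show thesis
  proof (rule that[of "apply_bcontfun f"])
    show "\<Phi> (apply_bcontfun f) z = f z" if "z \<in> cbox a b" for z
      using \<Psi>[of f z] that f by simp
  qed simp
qed

text \<open>The factor 1/b, uniform in \<open>t\<close>, is the smallness on which the contraction
  rests.\<close>

lemma integral_mult_exp_bound:
  fixes h :: "real \<Rightarrow> real"
  assumes h: "continuous_on {0..t} h" and M: "\<And>s. s \<in> {0..t} \<Longrightarrow> \<bar>h s\<bar> \<le> M" and "0 < b" "0 \<le> t"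
  shows "\<bar>integral {0..t} (\<lambda>s. h s * exp (- b * (t - s)))\<bar> \<le> M / b"
proof -
  have "0 \<le> M" using M[of 0] \<open>0 \<le> t\<close> by force
  have I: "((\<lambda>s. M * exp (- b * (t - s))) has_integral
      M / b * exp (- b * (t - t)) - M / b * exp (- b * (t - 0))) {0..t}"
    using \<open>0 < b\<close> \<open>0 \<le> t\<close> by (intro fundamental_theorem_of_calculus)
      (auto intro!: derivative_eq_intros simp flip: has_real_derivative_iff_has_vector_derivative)
  have "integral {0..t} (\<lambda>s. M * exp (- b * (t - s))) = M / b - M / b * exp (- b * (t - 0))"
    by (simp only: integral_unique[OF I]) simp
  moreover have "norm (integral {0..t} (\<lambda>s. h s * exp (- b * (t - s)))) \<le>
      integral {0..t} (\<lambda>s. M * exp (- b * (t - s)))"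
    using M by (intro integral_norm_bound_integral integrable_continuous_interval continuous_intros h)
      (auto simp: abs_mult)
  moreover have "M / b * exp (- b * (t - 0)) \<ge> 0"
    using \<open>0 \<le> M\<close> \<open>0 < b\<close> by simp
  ultimately show ?thesis
    unfolding real_norm_def by linarith
qed

text \<open>Variation of constants for \<open>y'' = r\<^sup>2 (y - f)\<close>, \<open>y 0 = y 1\<close>, \<open>y' 0 = 0\<close>; the
  constant \<open>bvp_const\<close> is \<open>y 0\<close>.\<close>

definition cosh_integral :: "real \<Rightarrow> (real \<Rightarrow> real) \<Rightarrow> real \<Rightarrow> real" where
  "cosh_integral r f x = integral {0..x} (\<lambda>s. f s * cosh (r * s))"

definition sinh_integral :: "real \<Rightarrow> (real \<Rightarrow> real) \<Rightarrow> real \<Rightarrow> real" where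
  "sinh_integral r f x = integral {0..x} (\<lambda>s. f s * sinh (r * s))"

definition bvp_const :: "real \<Rightarrow> (real \<Rightarrow> real) \<Rightarrow> real" where
  "bvp_const r f = r * (sinh r * cosh_integral r f 1 - cosh r * sinh_integral r f 1) / (cosh r - 1)"

definition bvp_solution :: "real \<Rightarrow> (real \<Rightarrow> real) \<Rightarrow> real \<Rightarrow> real" where
  "bvp_solution r f x = bvp_const r f * cosh (r * x)
     - r * (sinh (r * x) * cosh_integral r f x - cosh (r * x) * sinh_integral r f x)"

definition bvp_solution_deriv :: "real \<Rightarrow> (real \<Rightarrow> real) \<Rightarrow> real \<Rightarrow> real" where
  "bvp_solution_deriv r f x = r * (bvp_const r f * sinh (r * x)
     - r * (cosh (r * x) * cosh_integral r f x - sinh (r * x) * sinh_integral r f x))"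

lemma
  assumes f: "continuous_on {0..1} f" and x: "x \<in> {0..1}"
  shows cosh_integral_deriv:
      "(cosh_integral r f has_real_derivative f x * cosh (r * x)) (at x within {0..1})"
    and sinh_integral_deriv:
      "(sinh_integral r f has_real_derivative f x * sinh (r * x)) (at x within {0..1})"
  unfolding cosh_integral_def sinh_integral_def
  by (rule integral_has_real_derivative; intro continuous_intros f x)+

text \<open>The pointwise terms in \<open>f\<close> cancel, being f (sinh cosh - cosh sinh). The
  first derivative thus contains \<open>f\<close> only under integrals and can be differentiated
  again for continuous \<open>f\<close>.\<close>

lemma bvp_solution_has_deriv:
  assumes f: "continuous_on {0..1} f" and x: "x \<in> {0..1}"
  shows "(bvp_solution r f has_real_derivative bvp_solution_deriv r f x) (at x within {0..1})"
  unfolding bvp_solution_def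
  by (auto intro!: derivative_eq_intros cosh_integral_deriv[OF f x] sinh_integral_deriv[OF f x]
      simp: bvp_solution_deriv_def algebra_simps)

text \<open>This time the pointwise terms add up to f (cosh^2 - sinh^2) = f.\<close>

lemma bvp_solution_deriv_has_deriv:
  assumes f: "continuous_on {0..1} f" and x: "x \<in> {0..1}"
  shows "(bvp_solution_deriv r f has_real_derivative r\<^sup>2 * (bvp_solution r f x - f x)) (at x within {0..1})"
proof -
  define C S P Q A where "C = cosh (r * x)" and "S = sinh (r * x)"
    and "P = cosh_integral r f x" and "Q = sinh_integral r f x" and "A = bvp_const r f"
  have "(bvp_solution_deriv r f has_real_derivative
      r * (A * (C * r) - r * ((S * r * P + C * (f x * C)) - (C * r * Q + S * (f x * S))))) (at x within {0..1})"
    unfolding bvp_solution_deriv_def C_def S_def P_def Q_def A_def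
    by (auto intro!: derivative_eq_intros cosh_integral_deriv[OF f x] sinh_integral_deriv[OF f x]
      simp: algebra_simps)
  also have "r * (A * (C * r) - r * ((S * r * P + C * (f x * C)) - (C * r * Q + S * (f x * S))))
      = r\<^sup>2 * (A * C - r * (S * P - C * Q) - f x * (C\<^sup>2 - S\<^sup>2))"
    by (simp add: power2_eq_square algebra_simps)
  also have "C\<^sup>2 - S\<^sup>2 = 1"
    by (simp add: C_def S_def cosh_square_eq)
  finally show ?thesis
    unfolding bvp_solution_def C_def S_def P_def Q_def A_def by simp
qed

lemma cosh_integral_0 [simp]: "cosh_integral r f 0 = 0"
  and sinh_integral_0 [simp]: "sinh_integral r f 0 = 0"
  by (simp_all add: cosh_integral_def sinh_integral_def)

lemma bvp_solution_deriv_0: "bvp_solution_deriv r f 0 = 0"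
  by (simp add: bvp_solution_deriv_def)

lemma cosh_gt_1: "r \<noteq> 0 \<Longrightarrow> cosh (r::real) > 1"
  using cosh_real_ge_1[of r] cosh_real_one_iff[of r] by linarith

text \<open>\<open>bvp_const\<close> is this equation solved for the value at 0. That is possible
  since cosh r - 1 > 0, that is, since the homogeneous problem has only the zero solution.\<close>

lemma bvp_solution_periodic:
  assumes "r \<noteq> 0"
  shows "bvp_solution r f 0 = bvp_solution r f 1"
proof -
  have "bvp_const r f * (cosh r - 1) = r * (sinh r * cosh_integral r f 1 - cosh r * sinh_integral r f 1)"
    using cosh_gt_1[OF assms] by (simp add: bvp_const_def)
  then show ?thesis
    by (simp add: bvp_solution_def algebra_simps)
qed

lemma bvp_solution_mult: "bvp_solution r (\<lambda>s. k * f s) x = k * bvp_solution r f x"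
  by (simp add: bvp_solution_def bvp_const_def cosh_integral_def sinh_integral_def mult.assoc
      right_diff_distrib mult.left_commute)

lemma bvp_solution_cong:
  assumes "\<And>s. s \<in> {0..1} \<Longrightarrow> f s = h s" "x \<in> {0..1}"
  shows "bvp_solution r f x = bvp_solution r h x"
proof -
  have "cosh_integral r f y = cosh_integral r h y" "sinh_integral r f y = sinh_integral r h y"
    if "y \<in> {0..1}" for y
    unfolding cosh_integral_def sinh_integral_def using assms(1) that
    by (auto intro!: integral_cong)
  then show ?thesis
    using assms(2) by (simp add: bvp_solution_def bvp_const_def)
qed

lemma bvp_solution_diff:
  assumes f: "continuous_on {0..1} f" and h: "continuous_on {0..1} h" and x: "x \<in> {0..1}"
  shows "bvp_solution r (\<lambda>s. f s - h s) x = bvp_solution r f x - bvp_solution r h x"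
proof -
  have eqs: "cosh_integral r (\<lambda>s. f s - h s) y = cosh_integral r f y - cosh_integral r h y"
    "sinh_integral r (\<lambda>s. f s - h s) y = sinh_integral r f y - sinh_integral r h y"
    if "y \<in> {0..1}" for y
  proof -
    have sub: "{0..y} \<subseteq> {0..1}" using that by auto
    note f' = continuous_on_subset[OF f sub] and h' = continuous_on_subset[OF h sub]
    show "cosh_integral r (\<lambda>s. f s - h s) y = cosh_integral r f y - cosh_integral r h y"
      "sinh_integral r (\<lambda>s. f s - h s) y = sinh_integral r f y - sinh_integral r h y"
      unfolding cosh_integral_def sinh_integral_def left_diff_distrib
      by (intro integral_diff integrable_continuous_interval continuous_intros f' h')+
  qed
  have const: "bvp_const r (\<lambda>s. f s - h s) = bvp_const r f - bvp_const r h"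
    unfolding bvp_const_def diff_divide_distrib[symmetric] by (simp add: eqs algebra_simps)
  show ?thesis
    by (simp add: bvp_solution_def const eqs[OF x] algebra_simps)
qed

text \<open>Any \<open>K\<close> that depends on \<open>r\<close> alone will do, because the weight
  is adapted to \<open>K\<close> afterwards. On the unit interval both hyperbolic functions are
  bounded by cosh r, which gives the constant.\<close>

lemma bvp_solution_bound:
  assumes "0 < r"
  obtains K where "0 < K" and "\<And>f M x. \<lbrakk>continuous_on {0..1} f; \<And>s. s \<in> {0..1} \<Longrightarrow> \<bar>f s\<bar> \<le> M; x \<in> {0..1}\<rbrakk>
    \<Longrightarrow> \<bar>bvp_solution r f x\<bar> \<le> K * M"
proof -
  define c where "c = cosh r"
  have c: "c > 1" unfolding c_def using assms by (intro cosh_gt_1) simp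
  have cosh_le: "\<bar>cosh (r * x)\<bar> \<le> c" and sinh_le: "\<bar>sinh (r * x)\<bar> \<le> c" if "x \<in> {0..1}" for x
  proof -
    have "r * x \<le> r" using that assms by (simp add: mult_left_le)
    then show *: "\<bar>cosh (r * x)\<bar> \<le> c"
      unfolding c_def using that assms by (simp add: cosh_real_nonneg_le_iff)
    have "\<bar>sinh (r * x)\<bar> \<le> cosh (r * x)"
      using that assms sinh_less_cosh_real[of "r * x"] by (simp add: less_imp_le)
    with * show "\<bar>sinh (r * x)\<bar> \<le> c" by linarith
  qed
  have main: "\<bar>bvp_solution r f x\<bar> \<le> (2 * r * c * c / (c - 1) * c + 2 * r * c * c) * M"
    if f: "continuous_on {0..1} f" and M: "\<And>s. s \<in> {0..1} \<Longrightarrow> \<bar>f s\<bar> \<le> M" and x: "x \<in> {0..1}" for f M x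
  proof -
    have "0 \<le> M" using M[of 0] by force
    have int_le: "\<bar>cosh_integral r f y\<bar> \<le> c * M" "\<bar>sinh_integral r f y\<bar> \<le> c * M" if y: "y \<in> {0..1}" for y
    proof -
      have sub: "{0..y} \<subseteq> {0..1}" using y by auto
      note f' = continuous_on_subset[OF f sub]
      have gen: "\<bar>integral {0..y} (\<lambda>s. f s * k s)\<bar> \<le> c * M"
        if k: "continuous_on {0..y} k" "\<And>s. s \<in> {0..1} \<Longrightarrow> \<bar>k s\<bar> \<le> c" for k
      proof -
        have "norm (integral {0..y} (\<lambda>s. f s * k s)) \<le> M * c * (y - 0)"
        proof (rule integral_bound)
          show "norm (f s * k s) \<le> M * c" if "s \<in> {0..y}" for s
            using mult_mono[OF M k(2)] that sub \<open>0 \<le> M\<close> by (auto simp: abs_mult)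
        qed (use y in \<open>auto intro!: continuous_intros f' k\<close>)
        also have "\<dots> \<le> M * c"
          using y \<open>0 \<le> M\<close> c by (intro mult_left_le) auto
        finally show ?thesis by (simp add: mult.commute)
      qed
      show "\<bar>cosh_integral r f y\<bar> \<le> c * M" "\<bar>sinh_integral r f y\<bar> \<le> c * M"
        unfolding cosh_integral_def sinh_integral_def
        by (rule gen; intro continuous_intros cosh_le sinh_le; assumption)+
    qed
    have comb: "\<bar>sinh (r * y) * cosh_integral r f y - cosh (r * y) * sinh_integral r f y\<bar> \<le> 2 * c * c * M"
      if y: "y \<in> {0..1}" for y
    proof -
      have "\<bar>sinh (r * y)\<bar> * \<bar>cosh_integral r f y\<bar> \<le> c * (c * M)" "\<bar>cosh (r * y)\<bar> * \<bar>sinh_integral r f y\<bar> \<le> c * (c * M)"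
        using cosh_le[OF y] sinh_le[OF y] int_le[OF y] c by (intro mult_mono; simp)+
      then show ?thesis
        using abs_triangle_ineq4[of "sinh (r * y) * cosh_integral r f y" "cosh (r * y) * sinh_integral r f y"]
        by (simp add: abs_mult)
    qed
    have "\<bar>bvp_const r f\<bar> \<le> r * (2 * c * c * M) / (c - 1)"
    proof -
      have "\<bar>bvp_const r f\<bar> = r * \<bar>sinh r * cosh_integral r f 1 - cosh r * sinh_integral r f 1\<bar> / (c - 1)"
        using c assms by (simp add: bvp_const_def abs_mult c_def)
      also have "\<dots> \<le> r * (2 * c * c * M) / (c - 1)"
        using comb[of 1] c assms by (intro divide_right_mono mult_left_mono) auto
      finally show ?thesis .
    qed
    then have "\<bar>bvp_const r f\<bar> * \<bar>cosh (r * x)\<bar> \<le> r * (2 * c * c * M) / (c - 1) * c"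
      using cosh_le[OF x] c assms \<open>0 \<le> M\<close> by (intro mult_mono) auto
    moreover have "r * \<bar>sinh (r * x) * cosh_integral r f x - cosh (r * x) * sinh_integral r f x\<bar> \<le> r * (2 * c * c * M)"
      using comb[OF x] assms by (intro mult_left_mono) auto
    moreover have "\<bar>bvp_solution r f x\<bar> \<le> \<bar>bvp_const r f\<bar> * \<bar>cosh (r * x)\<bar>
        + r * \<bar>sinh (r * x) * cosh_integral r f x - cosh (r * x) * sinh_integral r f x\<bar>"
      unfolding bvp_solution_def
      by (rule order_trans[OF abs_triangle_ineq4]) (use assms in \<open>simp add: abs_mult\<close>)
    ultimately show ?thesis
      by (simp add: algebra_simps)
  qed
  show thesis
  proof (rule that[of "2 * r * c * c / (c - 1) * c + 2 * r * c * c"])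
    show "0 < 2 * r * c * c / (c - 1) * c + 2 * r * c * c"
      using c assms by (intro add_pos_pos mult_pos_pos divide_pos_pos) auto
  qed (rule main)
qed

lemma continuous_on_bvp_solution:
  assumes F: "continuous_on ({0..1} \<times> B) (\<lambda>(x,t). F x t)" and r: "r \<noteq> 0"
  shows "continuous_on ({0..1} \<times> B) (\<lambda>(x,t). bvp_solution r (\<lambda>s. F s t) x)"
    and "continuous_on ({0..1} \<times> B) (\<lambda>(x,t). bvp_solution_deriv r (\<lambda>s. F s t) x)"
proof -
  \<comment> \<open>The coordinates are swapped because the variable upper limit, here x, has to be
    the second one.\<close>
  have "continuous_on (B \<times> {0..1}) (\<lambda>z. (\<lambda>(x,t). F x t) (snd z, fst z))"
    by (rule continuous_on_compose2[OF F]) (auto intro!: continuous_intros)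
  then have F': "continuous_on (B \<times> {0..1}) (\<lambda>z. F (snd z) (fst z))"
    by simp
  have int: "continuous_on (B \<times> {0..1}) (\<lambda>(t,x). integral {0..x} (\<lambda>s. F s t * k s))"
    if "continuous_on UNIV k" for k
  proof (rule continuous_on_integral_upper_limit)
    have "continuous_on (B \<times> {0..1::real}) (\<lambda>z. k (snd z))"
      by (rule continuous_on_compose2[OF that]) (auto intro!: continuous_intros)
    then show "continuous_on (B \<times> {0..1}) (\<lambda>(t,s). F s t * k s)"
      using F' by (auto simp: case_prod_unfold intro!: continuous_intros)
  qed
  have int': "continuous_on ({0..1} \<times> B) (\<lambda>z. integral {0..fst z} (\<lambda>s. F s (snd z) * k s))"
    and int1: "continuous_on ({0..1::real} \<times> B) (\<lambda>z. integral {0..1} (\<lambda>s. F s (snd z) * k s))"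
    if k: "continuous_on UNIV k" for k
  proof -
    have "continuous_on ({0..1} \<times> B) (\<lambda>z. (\<lambda>(t,x). integral {0..x} (\<lambda>s. F s t * k s)) (snd z, fst z))"
      "continuous_on ({0..1::real} \<times> B) (\<lambda>z. (\<lambda>(t,x). integral {0..x} (\<lambda>s. F s t * k s)) (snd z, 1))"
      by (rule continuous_on_compose2[OF int[OF k]]; auto intro!: continuous_intros)+
    then show "continuous_on ({0..1} \<times> B) (\<lambda>z. integral {0..fst z} (\<lambda>s. F s (snd z) * k s))"
      "continuous_on ({0..1::real} \<times> B) (\<lambda>z. integral {0..1} (\<lambda>s. F s (snd z) * k s))"
      by simp_all
  qed
  have k: "continuous_on UNIV (\<lambda>s. cosh (r * s))" "continuous_on UNIV (\<lambda>s. sinh (r * s))"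
    by (intro continuous_intros)+
  note ints = int'[OF k(1)] int'[OF k(2)] int1[OF k(1)] int1[OF k(2)]
  show "continuous_on ({0..1} \<times> B) (\<lambda>(x,t). bvp_solution r (\<lambda>s. F s t) x)"
    "continuous_on ({0..1} \<times> B) (\<lambda>(x,t). bvp_solution_deriv r (\<lambda>s. F s t) x)"
    unfolding bvp_solution_def bvp_solution_deriv_def bvp_const_def cosh_integral_def sinh_integral_def case_prod_unfold
    by (intro continuous_intros ints; simp add: r)+
qed

lemma regular_solution_exists:
  fixes \<alpha> T :: real and g :: "real \<Rightarrow> real \<Rightarrow> real"
  assumes \<alpha>: "0 < \<alpha>" "\<alpha> < 1" and T: "0 < T"
    and g: "continuous_on ({0..1} \<times> {0..T}) (\<lambda>(x,t). g x t)"
    and g0: "\<And>x. x \<in> {0..1} \<Longrightarrow> g x 0 = 0"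
  obtains u where "regular_solution \<alpha> T g u"
proof -
  define c where "c = 1 - \<alpha>"
  define a where "a = \<alpha> / c"
  \<comment> \<open>With r^2 = 1/c the equation y'' = r^2 (y - f) reads y - c y'' = f.\<close>
  define r where "r = 1 / sqrt c"
  have c: "0 < c" and a: "0 < a" and r: "0 < r" and r2: "r\<^sup>2 = 1 / c"
    using \<alpha> by (auto simp: c_def a_def r_def power_divide)
  obtain K where K: "0 < K"
    "\<And>f M x. \<lbrakk>continuous_on {0..1} f; \<And>s. s \<in> {0..1} \<Longrightarrow> \<bar>f s\<bar> \<le> M; x \<in> {0..1}\<rbrakk>
      \<Longrightarrow> \<bar>bvp_solution r f x\<bar> \<le> K * M"
    using bvp_solution_bound[OF r] by blast
  \<comment> \<open>The contraction constant is K a / b with b = a + \<beta>; this \<beta> brings it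
    down to at most 1/2.\<close>
  define \<beta> where "\<beta> = 2 * K * a"
  define b where "b = a + \<beta>"
  have b: "0 < b"
    using K(1) a by (simp add: b_def \<beta>_def add_pos_pos)
  have contr: "K * (a * (M / b)) \<le> 1/2 * M" if "0 \<le> M" for M
  proof -
    have "2 * K * a \<le> b" using a by (simp add: b_def \<beta>_def)
    then have "2 * K * a * M \<le> b * M" using that by (rule mult_right_mono)
    then show ?thesis using b by (simp add: field_simps)
  qed
  \<comment> \<open>Here \<open>w\<close> stands for exp (- \<beta> t) u and \<open>N\<close> for
    the right-hand side with the same weight; the weight changes the rate of the memory kernel from
    \<open>a\<close> to \<open>b\<close>.\<close>
  define N where "N w y t = c * g y t * exp (- \<beta> * t) + a * integral {0..t} (\<lambda>s. w (y, s) * exp (- b * (t - s)))"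
    for w :: "real \<times> real \<Rightarrow> real" and y t
  define \<Phi> where "\<Phi> w z = bvp_solution r (\<lambda>y. N w y (snd z)) (fst z)" for w z
  have rect: "cbox (0,0) (1,T) = {0..1::real} \<times> {0..T}"
    by (simp add: cbox_Pair_eq)
  have mem: "continuous_on ({0..1} \<times> {0..T}) (\<lambda>(y,t). integral {0..t} (\<lambda>s. w (y, s) * exp (- k * (t - s))))"
    if w: "continuous_on ({0..1} \<times> {0..T}) w" for w :: "real \<times> real \<Rightarrow> real" and k
  proof -
    have "continuous_on ({0..1} \<times> {0..T}) (\<lambda>(y,t). integral {0..t} (\<lambda>s. w (y, s) * exp (k * s)))"
      using w by (intro continuous_on_integral_upper_limit) (auto simp: case_prod_unfold intro!: continuous_intros)
    then show ?thesis
      unfolding integral_mult_exp_diff case_prod_unfold by (intro continuous_intros)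
  qed
  have N: "continuous_on ({0..1} \<times> {0..T}) (\<lambda>(y,t). N w y t)"
    if "continuous_on ({0..1} \<times> {0..T}) w" for w
    using mem[OF that, of b] g unfolding N_def case_prod_unfold by (intro continuous_intros)
  obtain w where w: "continuous_on (cbox (0,0) (1,T)) w"
    and fix_w: "\<And>z. z \<in> cbox (0,0) (1,T) \<Longrightarrow> \<Phi> w z = w z"
  proof (rule contraction_fixed_point_cbox[of "(0,0)" "(1,T)" "1/2" \<Phi>])
    show "cbox (0,0) (1,T) \<noteq> ({} :: (real \<times> real) set)"
      using T by (simp add: rect)
    show "continuous_on (cbox (0,0) (1,T)) (\<Phi> w)" if "continuous_on (cbox (0,0) (1,T)) w" for w
      using continuous_on_bvp_solution(1)[OF N[OF that[unfolded rect]], of r] r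
      unfolding rect \<Phi>_def case_prod_unfold by simp
    show "\<bar>\<Phi> v z - \<Phi> w z\<bar> \<le> 1/2 * M"
      if v: "continuous_on (cbox (0,0) (1,T)) v" and w: "continuous_on (cbox (0,0) (1,T)) w"
        and M: "\<And>z. z \<in> cbox (0,0) (1,T) \<Longrightarrow> \<bar>v z - w z\<bar> \<le> M" and z: "z \<in> cbox (0,0) (1,T)" for v w M z
    proof -
      obtain x t where xt: "z = (x,t)" "x \<in> {0..1}" "t \<in> {0..T}"
        using z by (cases z) (auto simp: rect)
      have "0 \<le> M" using M[OF z] by linarith
      note Nv = continuous_on_section(2)[OF N[OF v[unfolded rect]] xt(3)]
        and Nw = continuous_on_section(2)[OF N[OF w[unfolded rect]] xt(3)]
      have sect: "continuous_on {0..t} (\<lambda>s. h (y, s))"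
        if "continuous_on (cbox (0,0) (1,T)) h" "y \<in> {0..1}" for h :: "real \<times> real \<Rightarrow> real" and y
        by (rule continuous_on_compose2[OF that(1)]) (use that(2) xt(3) in \<open>auto intro!: continuous_intros simp: rect\<close>)
      have "\<bar>N v y t - N w y t\<bar> \<le> a * (M / b)" if y: "y \<in> {0..1}" for y
      proof -
        have "N v y t - N w y t = a * integral {0..t} (\<lambda>s. (v (y, s) - w (y, s)) * exp (- b * (t - s)))"
          unfolding N_def left_diff_distrib
          by (subst integral_diff)
            (auto intro!: integrable_continuous_interval continuous_intros sect v w y simp: algebra_simps)
        moreover have "a * \<bar>integral {0..t} (\<lambda>s. (v (y, s) - w (y, s)) * exp (- b * (t - s)))\<bar> \<le> a * (M / b)"
          using xt(3) y b a
          by (intro mult_left_mono integral_mult_exp_bound M continuous_intros sect v w) (auto simp: rect)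
        ultimately show ?thesis
          by (simp only: abs_mult abs_of_pos[OF a])
      qed
      then have "\<bar>bvp_solution r (\<lambda>y. N v y t - N w y t) x\<bar> \<le> K * (a * (M / b))"
        by (intro K(2) xt(2) continuous_intros Nv Nw)
      then show ?thesis
        using contr[OF \<open>0 \<le> M\<close>]
        unfolding bvp_solution_diff[OF Nv Nw xt(2)] \<Phi>_def xt(1) fst_conv snd_conv by (rule order_trans)
    qed
  qed auto
  define u where "u x t = exp (\<beta> * t) * w (x, t)" for x t
  define F where "F y t = c * g y t + a * integral {0..t} (\<lambda>s. u y s * exp (- a * (t - s)))" for y t
  have uc: "continuous_on ({0..1} \<times> {0..T}) (\<lambda>(x,t). u x t)"
    using w unfolding rect u_def case_prod_unfold by (auto intro!: continuous_intros)
  then have Fc: "continuous_on ({0..1} \<times> {0..T}) (\<lambda>(x,t). F x t)"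
    using mem[of "\<lambda>z. u (fst z) (snd z)" a] g unfolding F_def case_prod_unfold by (auto intro!: continuous_intros)
  have u_eq: "u x t = bvp_solution r (\<lambda>y. F y t) x" if "x \<in> {0..1}" "t \<in> {0..T}" for x t
  proof -
    have "exp (\<beta> * t) * N w y t = F y t" for y
    proof -
      have "u y s * exp (- a * (t - s)) = exp (\<beta> * t) * (w (y, s) * exp (- b * (t - s)))" for s
        by (simp add: u_def b_def algebra_simps flip: exp_add)
      then show ?thesis
        by (simp add: F_def N_def algebra_simps flip: exp_add)
    qed
    moreover have "u x t = bvp_solution r (\<lambda>y. exp (\<beta> * t) * N w y t) x"
      using fix_w[of "(x,t)"] that unfolding bvp_solution_mult by (simp add: rect \<Phi>_def u_def)
    ultimately show ?thesis by simp
  qed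
  have u_initial: "u x 0 = 0" if x: "x \<in> {0..1}" for x
  proof -
    \<comment> \<open>At t = 0 the source \<open>F\<close> vanishes. The zero is written as a
      product so that homogeneity of \<open>bvp_solution\<close> yields 0.\<close>
    have "u x 0 = bvp_solution r (\<lambda>y. 0 * 0) x"
      unfolding u_eq[OF x, of 0, simplified, OF less_imp_le[OF T]]
      by (rule bvp_solution_cong[OF _ x]) (simp add: F_def g0)
    then show ?thesis unfolding bvp_solution_mult by simp
  qed
  define ux where "ux x t = bvp_solution_deriv r (\<lambda>y. F y t) x" for x t
  \<comment> \<open>Defined through the differential equation of \<open>bvp_solution\<close>, so
    that joint continuity is immediate and the equation to be checked becomes algebra.\<close>
  define uxx where "uxx x t = r\<^sup>2 * (u x t - F x t)" for x t
  note Ft = continuous_on_section(2)[OF Fc]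
  have deriv_u: "((\<lambda>y. u y t) has_real_derivative ux x t) (at x within {0..1})"
    if "x \<in> {0..1}" "t \<in> {0..T}" for x t
    unfolding ux_def
    by (rule has_field_derivative_transform_within[OF bvp_solution_has_deriv[OF Ft[OF that(2)] that(1)], of 1])
      (use that u_eq in auto)
  have "regular_solution \<alpha> T g u"
    unfolding regular_solution_def
  proof (intro conjI ballI)
    show "continuous_on ({0..1} \<times> {0..T}) (\<lambda>(x,t). u x t)" by (rule uc)
    show "\<exists>ux uxx.
        (\<forall>x\<in>{0..1}. \<forall>t\<in>{0<..<T}. ((\<lambda>y. u y t) has_real_derivative ux x t) (at x within {0..1})) \<and>
        continuous_on ({0..1} \<times> {0<..<T}) (\<lambda>(x,t). ux x t) \<and>
        (\<forall>(x,t)\<in>Omega T. ((\<lambda>y. ux y t) has_real_derivative uxx x t) (at x)) \<and>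
        continuous_on (Omega T) (\<lambda>(x,t). uxx x t) \<and>
        (\<forall>(x,t)\<in>Omega T. caputo_fabrizio \<alpha> (u x) t - uxx x t = g x t) \<and>
        (\<forall>t\<in>{0<..<T}. ux 0 t = 0)"
    proof (rule exI[of _ ux], rule exI[of _ uxx], intro conjI ballI)
      show "continuous_on ({0..1} \<times> {0<..<T}) (\<lambda>(x,t). ux x t)"
        unfolding ux_def
        by (rule continuous_on_subset[OF continuous_on_bvp_solution(2)[OF Fc]]) (use r in auto)
      show "continuous_on (Omega T) (\<lambda>(x,t). uxx x t)"
        using uc Fc unfolding uxx_def case_prod_unfold
        by (intro continuous_on_subset[of "{0..1} \<times> {0..T}" _ "Omega T"] continuous_intros) (auto simp: Omega_def)
      show "((\<lambda>y. u y t) has_real_derivative ux x t) (at x within {0..1})"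
        if "x \<in> {0..1}" "t \<in> {0<..<T}" for x t
        using that by (intro deriv_u) auto
      show "case z of (x,t) \<Rightarrow> ((\<lambda>y. ux y t) has_real_derivative uxx x t) (at x)" if z: "z \<in> Omega T" for z
      proof -
        obtain x t where xt: "z = (x,t)" "x \<in> {0<..<1}" "t \<in> {0<..<T}"
          using z by (auto simp: Omega_def)
        have "((\<lambda>y. ux y t) has_real_derivative uxx x t) (at x within {0..1})"
          using bvp_solution_deriv_has_deriv[OF Ft, of t x r] xt u_eq[of x t] by (simp add: ux_def uxx_def)
        then show ?thesis
          using xt at_within_interior[of x "{0..1}"] by (simp add: interior_atLeastAtMost_real)
      qed
      show "case z of (x,t) \<Rightarrow> caputo_fabrizio \<alpha> (u x) t - uxx x t = g x t" if z: "z \<in> Omega T" for z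
      proof -
        obtain x t where xt: "z = (x,t)" "x \<in> {0<..<1}" "t \<in> {0<..<T}"
          using z by (auto simp: Omega_def)
        define J where "J = integral {0..t} (\<lambda>s. u x s * exp (- a * (t - s)))"
        have cf: "caputo_fabrizio \<alpha> (u x) t = 1 / c * u x t - \<alpha> / c\<^sup>2 * J"
          using u_initial[of x] xt by (simp add: caputo_fabrizio_def J_def a_def c_def)
        have uxx_eq: "uxx x t = 1 / c * (u x t - (c * g x t + \<alpha> / c * J))"
          by (simp add: uxx_def r2 F_def J_def a_def)
        show ?thesis
          unfolding xt(1) case_prod_conv cf uxx_eq using c by (simp add: field_simps power2_eq_square)
      qed
      show "ux 0 t = 0" if "t \<in> {0<..<T}" for t
        by (simp add: ux_def bvp_solution_deriv_0)
    qed
    show "u x 0 = 0" if "x \<in> {0..1}" for x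
      by (rule u_initial[OF that])
    show "u 0 t = u 1 t" if "t \<in> {0..T}" for t
      using u_eq[of 0 t] u_eq[of 1 t] that bvp_solution_periodic[of r] r by simp
  qed
  then show thesis by (rule that)
qed

theorem theorem5:
  fixes \<alpha> T :: real and g :: "real \<Rightarrow> real \<Rightarrow> real"
  assumes "0 < \<alpha>" and "\<alpha> < 1" and "0 < T"
    and "continuous_on ({0..1} \<times> {0..T}) (\<lambda>(x,t). g x t)"
    and "\<forall>x\<in>{0..1}. g x 0 = 0"
    and "\<forall>t\<in>{0..T}. g 0 t = g 1 t"
    and "\<forall>x\<in>{0..1}. deriv_in_Lp 1 0 T (\<lambda>t. g x t)"
    and "\<forall>t\<in>{0..T}. deriv_in_Lp 2 0 1 (\<lambda>x. g x t)"
  shows "\<exists>u. regular_solution \<alpha> T g u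
    \<and> (\<forall>v. regular_solution \<alpha> T g v \<longrightarrow> (\<forall>x\<in>{0..1}. \<forall>t\<in>{0..T}. v x t = u x t))
    \<and> (\<forall>x\<in>{0..1}. \<forall>t\<in>{0..T}.
         summable (\<lambda>k. u_cos_coeff \<alpha> g (Suc k) t * cos (2 * real (Suc k) * pi * x))
       \<and> summable (\<lambda>k. u_xsin_coeff \<alpha> g (Suc k) t * (x * sin (2 * real (Suc k) * pi * x)))
       \<and> u x t = (1 - \<alpha>) * g0 g t + \<alpha> * integral {0..t} (\<lambda>z. g0 g z)
           + (\<Sum>k. u_cos_coeff \<alpha> g (Suc k) t * cos (2 * real (Suc k) * pi * x))
           + (\<Sum>k. u_xsin_coeff \<alpha> g (Suc k) t * (x * sin (2 * real (Suc k) * pi * x))))"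
proof -
  note rep = regular_solution_representation[OF assms(1-4)]
  obtain u where u: "regular_solution \<alpha> T g u"
    by (rule regular_solution_exists[OF assms(1-4)]) (use assms(5) in auto)
  show ?thesis
  proof (intro exI[of _ u] conjI allI impI ballI)
    \<comment> \<open>Both functions are equal to one and the same expression in the data.\<close>
    show "v x t = u x t"
      if "regular_solution \<alpha> T g v" "x \<in> {0..1}" "t \<in> {0..T}" for v x t
      unfolding rep(3)[OF that] rep(3)[OF u that(2,3)] ..
  qed (rule u rep[OF u]; assumption)+
qed

end
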